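(* If $H$ is an abelian subgroup of a Garside group $G$, then $[N_G(H):Z_G(H)]<\infty$.
   Context: $Z_G(H)=\{g\in G: gh=hg\text{ for all }h\in H\}$ and $N_G(H)=\{g\in G: g^{-1}Hg=H\}$ are the centralizer and normalizer of $H$ in $G$. Garside groups. Let $M$ be a monoid. An atom is an element $a\in M\setminus\{1\}$ such that $a=bc$ implies $b=1$ or $c=1$. For $a\in M$, $|a|_{\max}$ is the supremum of the lengths of all expressions of $a$ in terms of atoms. $M$ is atomic if it is generated by its atoms and $|a|_{\max}<\infty$ for all $a\in M$. In an atomic monoid, $a\le_L b$ means $ac=b$ for some $c\in M$, and $a\le_R b$ means $ca=b$ for some $c\in M$; these are partial orders. A finitely generated monoid $M$ is a Garside monoid if it is atomic, left and right cancellative, the posets $(M,\le_L)$ and $(M,\le_R)$ are lattices, and there is an element $\Delta\in M$ (a Garside element) such that for every $a\in M$, $a\le_L\Delta$ iff $a\le_R\Delta$, and $\{a\in M: a\le_L\Delta\}$ generates $M$. A Garside group is the group of fractions of a Garside monoid. *)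

theory Defs
  imports "HOL-Algebra.Algebra" "HOL-Library.Extended_Nat"
begin

definition list_prod :: "('a, 'b) monoid_scheme \<Rightarrow> 'a list \<Rightarrow> 'a" where
  "list_prod M xs = foldr (\<lambda>x y. x \<otimes>\<^bsub>M\<^esub> y) xs \<one>\<^bsub>M\<^esub>"

definition generates :: "('a, 'b) monoid_scheme \<Rightarrow> 'a set \<Rightarrow> bool" where
  "generates M S \<longleftrightarrow> S \<subseteq> carrier M \<and> (\<forall>a\<in>carrier M. \<exists>xs. set xs \<subseteq> S \<and> list_prod M xs = a)"

definition atoms :: "('a, 'b) monoid_scheme \<Rightarrow> 'a set" where
  "atoms M = {a \<in> carrier M - {\<one>\<^bsub>M\<^esub>}.
     \<forall>b\<in>carrier M. \<forall>c\<in>carrier M. a = b \<otimes>\<^bsub>M\<^esub> c \<longrightarrow> b = \<one>\<^bsub>M\<^esub> \<or> c = \<one>\<^bsub>M\<^esub>}"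

definition max_length :: "('a, 'b) monoid_scheme \<Rightarrow> 'a \<Rightarrow> enat" where
  "max_length M a = (SUP xs \<in> {xs. set xs \<subseteq> atoms M \<and> list_prod M xs = a}. enat (length xs))"

locale atomic_monoid = monoid M for M (structure) +
  assumes atoms_generate: "generates M (atoms M)"
    and max_length_finite: "\<And>a. a \<in> carrier M \<Longrightarrow> max_length M a < \<infinity>"

definition left_le :: "('a, 'b) monoid_scheme \<Rightarrow> 'a \<Rightarrow> 'a \<Rightarrow> bool" where
  "left_le M a b \<longleftrightarrow> (\<exists>c\<in>carrier M. a \<otimes>\<^bsub>M\<^esub> c = b)"

definition right_le :: "('a, 'b) monoid_scheme \<Rightarrow> 'a \<Rightarrow> 'a \<Rightarrow> bool" where
  "right_le M a b \<longleftrightarrow> (\<exists>c\<in>carrier M. c \<otimes>\<^bsub>M\<^esub> a = b)"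

definition garside_element :: "('a, 'b) monoid_scheme \<Rightarrow> 'a \<Rightarrow> bool" where
  "garside_element M d \<longleftrightarrow> d \<in> carrier M \<and>
     (\<forall>a\<in>carrier M. left_le M a d \<longleftrightarrow> right_le M a d) \<and>
     generates M {a \<in> carrier M. left_le M a d}"

locale garside_monoid = atomic_monoid M + monoid_cancel M for M (structure) +
  assumes finitely_generated: "\<exists>S. finite S \<and> generates M S"
    and left_lattice: "lattice \<lparr>carrier = carrier M, eq = (=), le = left_le M\<rparr>"
    and right_lattice: "lattice \<lparr>carrier = carrier M, eq = (=), le = right_le M\<rparr>"
    and ex_garside_element: "\<exists>d. garside_element M d"

text \<open>
  The group \<open>G\<close>, together with the embedding \<open>\<iota>\<close>, is the group of (left) fractions of \<open>M\<close>. For a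
  Garside monoid \<open>M\<close>, which is cancellative and has common left and right multiples, such \<open>G\<close> and
  \<open>\<iota>\<close> exist and are unique up to isomorphism by Ore's theorem, and left and right fractions give
  the same group.
\<close>
definition group_of_fractions ::
  "('m, 'p) monoid_scheme \<Rightarrow> ('m \<Rightarrow> 'g) \<Rightarrow> ('g, 'q) monoid_scheme \<Rightarrow> bool" where
  "group_of_fractions M \<iota> G \<longleftrightarrow> group G \<and> \<iota> \<in> hom M G \<and> inj_on \<iota> (carrier M) \<and>
     carrier G = {inv\<^bsub>G\<^esub> (\<iota> a) \<otimes>\<^bsub>G\<^esub> \<iota> b | a b. a \<in> carrier M \<and> b \<in> carrier M}"

text \<open>
  \<open>M\<close> and \<open>\<iota>\<close> are parameters because HOL cannot quantify existentially over the element type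
  of \<open>M\<close>; in a theorem they are universally quantified.
\<close>
locale garside_group = garside_monoid M for M and \<iota> and G +
  assumes fractions: "group_of_fractions M \<iota> G"

definition centralizer :: "('a, 'b) monoid_scheme \<Rightarrow> 'a set \<Rightarrow> 'a set" where
  "centralizer G H = {g \<in> carrier G. \<forall>h\<in>H. g \<otimes>\<^bsub>G\<^esub> h = h \<otimes>\<^bsub>G\<^esub> g}"

text \<open>
  The library's \<^const>\<open>normalizer\<close> is the stabilizer of \<open>H\<close> under \<open>g H g\<inverse>\<close>. It agrees
  with the convention \<open>g\<inverse> H g = H\<close>:
\<close>
lemma (in group) normalizer_eq:
  assumes "H \<subseteq> carrier G"
  shows "normalizer G H = {g \<in> carrier G. (inv g <# H) #> g = H}"
proof -
  have sub: "g <# H \<subseteq> carrier G" if "g \<in> carrier G" for g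
    using l_coset_subset_G[OF assms that] .
  have "(g <# H) #> inv g = H \<longleftrightarrow> (inv g <# H) #> g = H" if g: "g \<in> carrier G" for g
  proof -
    have conj: "(inv x <# ((x <# H) #> inv x)) #> x = H" if x: "x \<in> carrier G" for x
    proof -
      have "inv x <# ((x <# H) #> inv x) = (inv x <# (x <# H)) #> inv x"
        using x sub by (simp add: coset_assoc)
      also have "inv x <# (x <# H) = H"
        using x assms by (simp add: lcos_m_assoc lcos_mult_one)
      finally show ?thesis
        using x assms by (simp add: coset_mult_assoc)
    qed
    show ?thesis
      using conj[OF g] conj[of "inv g"] g by auto
  qed
  then show ?thesis
    using assms by (auto simp: normalizer_def stabilizer_def)
qed

definition finite_index :: "('a, 'b) monoid_scheme \<Rightarrow> 'a set \<Rightarrow> 'a set \<Rightarrow> bool" where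
  "finite_index G K L \<longleftrightarrow>
     subgroup L (G\<lparr>carrier := K\<rparr>) \<and> finite (rcosets\<^bsub>G\<lparr>carrier := K\<rparr>\<^esub> L)"

end

theory Submission
  imports Defs
begin

text \<open>
  Let \<open>D\<close> be a central power of the Garside element and order \<open>G\<close> by
  \<open>x \<preceq> y \<longleftrightarrow> x\<inverse> y \<in> M\<close>; left multiplications preserve this order, and finite
  meets exist. Call \<open>h\<close> positive if \<open>x \<preceq> h x\<close> for some \<open>x\<close>, that is, if some
  conjugate of \<open>h\<close> lies in \<open>M\<close>. The set of such \<open>x\<close> is closed under meets and under
  the centralizer of \<open>h\<close>, so finitely many commuting positive elements are conjugated into
  \<open>M\<close> simultaneously. Let \<open>A = \<langle>H, D\<rangle>\<close>. Two consequences: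

  (1) The conjugates in \<open>A\<close> of a fixed element of \<open>A\<close> are conjugated simultaneously
  into one finite interval \<open>[D\<^sup>-\<^sup>r, D\<^sup>r]\<close>, so \<open>N(H)\<close> has finite orbits on \<open>A\<close>.

  (2) Order the positive elements of \<open>A\<close> by \<open>a \<unlhd> b\<close> iff \<open>b\<^sup>k a\<inverse>\<close> is positive
  for some \<open>k\<close>, and let the face of \<open>g\<close> be the set of all \<open>h\<close> with
  \<open>h \<unlhd> g\<close> and \<open>h\<inverse> \<unlhd> g\<close>. Strict chains have at most as many steps as \<open>D\<close>
  has divisors. For \<open>h\<close> in the face of \<open>g\<close>, the supremum of the slopes \<open>p/q\<close> with
  \<open>h\<^sup>q g\<^sup>-\<^sup>p\<close> positive modulo \<open>f\<close> is attained (translation numbers are rational).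
  At the maximum, \<open>h\<^sup>q g\<^sup>-\<^sup>p\<close> either lies in the face of \<open>f\<close> or gives an element
  strictly between \<open>f\<close> and \<open>g\<close>. Along a chain that cannot be refined, every step
  therefore adds rank one, so \<open>A\<close> has finite rank. As \<open>A\<close> is torsion free, an
  element of \<open>N(H)\<close> centralizing a suitable finite subset of \<open>A\<close> centralizes \<open>A\<close>.
\<close>

subsection \<open>Groups\<close>

lemma (in group) inv_cancel [simp]:
  assumes "x \<in> carrier G" "y \<in> carrier G"
  shows "inv x \<otimes> (x \<otimes> y) = y" "x \<otimes> (inv x \<otimes> y) = y"
  using assms by (simp_all add: m_assoc[symmetric])

lemma (in group) commutant_subgroup:
  assumes z: "z \<in> carrier G"
  shows "subgroup {a \<in> carrier G. z \<otimes> a = a \<otimes> z} G"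
proof (rule subgroupI)
  fix a assume "a \<in> {a \<in> carrier G. z \<otimes> a = a \<otimes> z}"
  then have a: "a \<in> carrier G" "z \<otimes> a = a \<otimes> z" by auto
  then have "z \<otimes> inv a = inv a \<otimes> (a \<otimes> z) \<otimes> inv a" using z by (simp add: m_assoc[symmetric])
  also have "\<dots> = inv a \<otimes> (z \<otimes> a) \<otimes> inv a" using a by simp
  also have "\<dots> = inv a \<otimes> z" using a(1) z by (simp add: m_assoc)
  finally show "inv a \<in> {a \<in> carrier G. z \<otimes> a = a \<otimes> z}" using a by simp
next
  fix a b assume "a \<in> {a \<in> carrier G. z \<otimes> a = a \<otimes> z}" "b \<in> {a \<in> carrier G. z \<otimes> a = a \<otimes> z}"
  then show "a \<otimes> b \<in> {a \<in> carrier G. z \<otimes> a = a \<otimes> z}"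
    using z m_assoc[of z a b] m_assoc[of a z b] m_assoc[of a b z] by auto
next
  show "{a \<in> carrier G. z \<otimes> a = a \<otimes> z} \<noteq> {}" using z by auto
qed auto

lemma (in group) conj_nat_pow:
  assumes "z \<in> carrier G" "h \<in> carrier G"
  shows "(z \<otimes> h \<otimes> inv z) [^] (n::nat) = z \<otimes> h [^] n \<otimes> inv z"
proof (induction n)
  case (Suc n)
  have "inv z \<otimes> (z \<otimes> (h \<otimes> inv z)) = h \<otimes> inv z"
    using assms by (simp add: m_assoc[symmetric])
  then show ?case using Suc assms by (simp add: m_assoc)
qed (use assms in simp)

lemma (in group) centralizer_subgroup:
  assumes "H \<subseteq> carrier G"
  shows "subgroup (centralizer G H) G"
proof -
  have "centralizer G H = (\<Inter>h\<in>H. {a \<in> carrier G. h \<otimes> a = a \<otimes> h}) \<inter> carrier G"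
    by (auto simp: centralizer_def)
  also have "subgroup \<dots> G"
  proof (cases "H = {}")
    case False
    then have "subgroup (\<Inter>h\<in>H. {a \<in> carrier G. h \<otimes> a = a \<otimes> h}) G"
      using assms commutant_subgroup by (intro subgroups_Inter) auto
    then show ?thesis using subgroup_self subgroups_Inter_pair by blast
  qed (use subgroup_self in simp)
  finally show ?thesis .
qed

lemma (in group) mem_normalizer_iff:
  assumes "H \<subseteq> carrier G"
  shows "z \<in> normalizer G H \<longleftrightarrow> z \<in> carrier G \<and> (\<lambda>h. z \<otimes> h \<otimes> inv z) ` H = H"
proof -
  have "z <# H #> inv z = (\<lambda>h. z \<otimes> h \<otimes> inv z) ` H" for z
    by (auto simp: l_coset_def r_coset_def)
  then show ?thesis using assms by (auto simp: normalizer_def stabilizer_def)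
qed

lemma (in group) centralizer_subset_normalizer:
  assumes "H \<subseteq> carrier G"
  shows "centralizer G H \<subseteq> normalizer G H"
proof
  fix z assume z: "z \<in> centralizer G H"
  have "z \<otimes> h \<otimes> inv z = h" if "h \<in> H" for h
    using z that assms by (auto simp: centralizer_def m_assoc subset_eq)
  then have "(\<lambda>h. z \<otimes> h \<otimes> inv z) ` H = H" by (auto simp: image_iff)
  then show "z \<in> normalizer G H" using z assms by (simp add: mem_normalizer_iff centralizer_def)
qed

text \<open>If the conjugates \<open>inv z \<otimes> s \<otimes> z\<close> of all
  \<open>s \<in> S\<close> agree for \<open>z\<close> and \<open>z'\<close>, then
  \<open>z \<otimes> inv z'\<close> commutes with \<open>S\<close>, and \<open>detect\<close> puts
  it in the centralizer. So these conjugates determine the coset, and finite orbits leave finitely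
  many tuples of them.\<close>

lemma (in group) finite_index_centralizer:
  assumes H: "H \<subseteq> carrier G" and S: "finite S" "S \<subseteq> carrier G"
    and orbits: "\<And>s. s \<in> S \<Longrightarrow> finite {z \<otimes> s \<otimes> inv z | z. z \<in> normalizer G H}"
    and detect: "\<And>z. \<lbrakk>z \<in> normalizer G H; \<forall>s\<in>S. z \<otimes> s = s \<otimes> z\<rbrakk> \<Longrightarrow> z \<in> centralizer G H"
  shows "finite_index G (normalizer G H) (centralizer G H)"
proof -
  let ?N = "normalizer G H" and ?Z = "centralizer G H"
  have N: "subgroup ?N G" using normalizer_imp_subgroup[OF H] .
  have Z: "subgroup ?Z G" using centralizer_subgroup[OF H] .
  have sub: "subgroup ?Z (G\<lparr>carrier := ?N\<rparr>)"
    using subgroup_incl[OF Z N centralizer_subset_normalizer[OF H]] .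
  \<comment> \<open>The inverse stands on the left so that equal values give equal right cosets, the
    kind counted by \<open>rcosets\<close>.\<close>
  define \<phi> where "\<phi> z = restrict (\<lambda>s. inv z \<otimes> s \<otimes> z) S" for z
  have Nc: "z \<in> carrier G" if "z \<in> ?N" for z using subgroup.mem_carrier[OF N that] .
  have "\<phi> ` ?N \<subseteq> (\<Pi>\<^sub>E s\<in>S. {z \<otimes> s \<otimes> inv z | z. z \<in> ?N})"
  proof clarify
    fix z assume z: "z \<in> ?N"
    have "inv z \<otimes> s \<otimes> z \<in> {z \<otimes> s \<otimes> inv z | z. z \<in> ?N}" for s
      using subgroup.m_inv_closed[OF N z] Nc[OF z] by (auto intro!: exI[of _ "inv z"])
    then show "\<phi> z \<in> (\<Pi>\<^sub>E s\<in>S. {z \<otimes> s \<otimes> inv z | z. z \<in> ?N})" by (auto simp: \<phi>_def)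
  qed
  then have fin: "finite (\<phi> ` ?N)"
    by (rule finite_subset) (intro finite_PiE S orbits)
  have eq: "?Z #> z = ?Z #> z'" if z: "z \<in> ?N" "z' \<in> ?N" and \<phi>: "\<phi> z = \<phi> z'" for z z'
  proof -
    define t where "t = z \<otimes> inv z'"
    have zc: "z \<in> carrier G" "z' \<in> carrier G" using z Nc by auto
    have tN: "t \<in> ?N" using z subgroup.m_closed[OF N] subgroup.m_inv_closed[OF N] by (simp add: t_def)
    have "t \<otimes> s = s \<otimes> t" if s: "s \<in> S" for s
    proof -
      have sc: "s \<in> carrier G" using s S by auto
      have "inv z \<otimes> s \<otimes> z = inv z' \<otimes> s \<otimes> z'" 
        using fun_cong[OF \<phi>, of s] s by (simp add: \<phi>_def)
      then have "z \<otimes> (inv z \<otimes> s \<otimes> z) \<otimes> inv z' = z \<otimes> (inv z' \<otimes> s \<otimes> z') \<otimes> inv z'" by simp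
      then show ?thesis using sc zc by (simp add: t_def m_assoc)
    qed
    then have "t \<in> ?Z" using detect tN by blast
    moreover have "z = t \<otimes> z'" using zc by (simp add: t_def m_assoc)
    ultimately show ?thesis
      using coset_join2[OF Nc[OF tN] Z] coset_mult_assoc[of ?Z t z'] Nc[OF tN] zc
        subgroup.subset[OF Z] by simp
  qed
  have "rcosets\<^bsub>G\<lparr>carrier := ?N\<rparr>\<^esub> ?Z = (\<lambda>z. ?Z #> z) ` ?N"
    by (auto simp: RCOSETS_def r_coset_def)
  \<comment> \<open>One chosen preimage per tuple exhibits the cosets as an image of the finite set
    of tuples.\<close>
  also have "\<dots> = (\<lambda>c. ?Z #> inv_into ?N \<phi> c) ` (\<phi> ` ?N)"
  proof -
    have "?Z #> inv_into ?N \<phi> (\<phi> z) = ?Z #> z" if "z \<in> ?N" for z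
      using that by (intro eq) (auto simp: inv_into_into f_inv_into_f)
    then show ?thesis by (simp add: image_image)
  qed
  finally show ?thesis unfolding finite_index_def using sub fin by simp
qed

subsection \<open>Left-ordered groups with meets and a central unit\<close>

text \<open>\<open>Q\<close> is the positive cone of the order, and \<open>inv z \<otimes> x \<in> Q\<close> reads \<open>z \<preceq> x\<close>.\<close>
locale garside_order = group G for G (structure) +
  fixes Q :: "'a set" and D :: 'a
  assumes Q_carrier: "Q \<subseteq> carrier G"
    and Q_one: "\<one> \<in> Q"
    and Q_mult: "\<lbrakk>a \<in> Q; b \<in> Q\<rbrakk> \<Longrightarrow> a \<otimes> b \<in> Q"
    and Q_antisym: "\<lbrakk>a \<in> Q; inv a \<in> Q\<rbrakk> \<Longrightarrow> a = \<one>"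
    and D_Q: "D \<in> Q"
    and D_central: "x \<in> carrier G \<Longrightarrow> x \<otimes> D = D \<otimes> x"
    and archimedean: "x \<in> carrier G \<Longrightarrow> \<exists>k::nat. D [^] k \<otimes> x \<in> Q"
    and finite_divisors: "finite {m \<in> Q. inv m \<otimes> D [^] (k::nat) \<in> Q}"
    and meets: "\<lbrakk>x \<in> carrier G; y \<in> carrier G\<rbrakk> \<Longrightarrow>
      \<exists>z\<in>carrier G. inv z \<otimes> x \<in> Q \<and> inv z \<otimes> y \<in> Q \<and>
        (\<forall>w\<in>carrier G. inv w \<otimes> x \<in> Q \<and> inv w \<otimes> y \<in> Q \<longrightarrow> inv w \<otimes> z \<in> Q)"
begin

definition le :: "'a \<Rightarrow> 'a \<Rightarrow> bool" (infix "\<preceq>" 50) where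
  "x \<preceq> y \<longleftrightarrow> x \<in> carrier G \<and> y \<in> carrier G \<and> inv x \<otimes> y \<in> Q"

lemma leD [dest]: "x \<preceq> y \<Longrightarrow> x \<in> carrier G" "x \<preceq> y \<Longrightarrow> y \<in> carrier G"
  by (auto simp: le_def)

lemma D_carrier [simp]: "D \<in> carrier G"
  using D_Q Q_carrier by auto

lemma le_refl [simp]: "x \<in> carrier G \<Longrightarrow> x \<preceq> x"
  by (simp add: le_def Q_one)

lemma le_trans [trans]:
  assumes "x \<preceq> y" "y \<preceq> z"
  shows "x \<preceq> z"
proof -
  have "inv x \<otimes> z = (inv x \<otimes> y) \<otimes> (inv y \<otimes> z)"
    using assms by (simp add: le_def m_assoc)
  then show ?thesis
    using assms Q_mult[of "inv x \<otimes> y" "inv y \<otimes> z"] by (simp add: le_def)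
qed

lemma le_antisym:
  assumes "x \<preceq> y" "y \<preceq> x"
  shows "x = y"
proof -
  have "inv (inv x \<otimes> y) = inv y \<otimes> x"
    using assms by (simp add: le_def inv_mult_group)
  then have "inv x \<otimes> y = \<one>"
    using assms Q_antisym by (auto simp: le_def)
  then show ?thesis
    using assms by (metis leD inv_equality inv_inv inv_closed)
qed

lemma le_mult_left:
  assumes "x \<preceq> y" "c \<in> carrier G"
  shows "c \<otimes> x \<preceq> c \<otimes> y"
proof -
  have "inv (c \<otimes> x) \<otimes> (c \<otimes> y) = inv x \<otimes> y"
    using assms by (auto simp: le_def inv_mult_group m_assoc)
  then show ?thesis
    using assms by (simp add: le_def)
qed

lemma D_pow_central: "x \<in> carrier G \<Longrightarrow> x \<otimes> D [^] (k::nat) = D [^] k \<otimes> x"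
proof (induction k)
  case (Suc k)
  then show ?case
    by (simp add: m_assoc[symmetric]) (simp add: m_assoc D_central)
qed simp

lemma D_pow_Q: "D [^] (k::nat) \<in> Q"
  by (induction k) (auto simp: Q_one Q_mult D_Q)

lemma le_D_pow_mult: "x \<in> carrier G \<Longrightarrow> x \<preceq> D [^] (k::nat) \<otimes> x"
  by (simp add: le_def D_pow_central[symmetric] m_assoc[symmetric] D_pow_Q)

text \<open>Translation by \<open>inv x\<close> embeds the interval into the divisors of
  \<open>D [^] k\<close>. The bound is the same for every \<open>x\<close>; the later counting
  arguments rely on that.\<close>

lemma finite_interval:
  assumes x: "x \<in> carrier G"
  shows "finite {w. x \<preceq> w \<and> w \<preceq> D [^] (k::nat) \<otimes> x}"
    and "card {w. x \<preceq> w \<and> w \<preceq> D [^] (k::nat) \<otimes> x} \<le> card {m \<in> Q. inv m \<otimes> D [^] k \<in> Q}"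
proof -
  let ?I = "{w. x \<preceq> w \<and> w \<preceq> D [^] k \<otimes> x}"
  have sub: "(\<lambda>w. inv x \<otimes> w) ` ?I \<subseteq> {m \<in> Q. inv m \<otimes> D [^] k \<in> Q}"
  proof safe
    fix w assume w: "x \<preceq> w" "w \<preceq> D [^] k \<otimes> x"
    then have wc: "w \<in> carrier G" by auto
    show "inv x \<otimes> w \<in> Q" using w by (simp add: le_def)
    have "inv (inv x \<otimes> w) \<otimes> D [^] k = inv w \<otimes> (D [^] k \<otimes> x)"
      using x wc by (simp add: inv_mult_group m_assoc D_pow_central[of x])
    then show "inv (inv x \<otimes> w) \<otimes> D [^] k \<in> Q" using w by (simp add: le_def)
  qed
  have inj: "inj_on (\<lambda>w. inv x \<otimes> w) ?I"
    using x by (intro inj_onI) (metis (no_types, lifting) l_cancel inv_closed leD(2) mem_Collect_eq)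
  show "finite ?I"
    using finite_subset[OF sub finite_divisors] inj by (rule finite_imageD)
  show "card ?I \<le> card {m \<in> Q. inv m \<otimes> D [^] k \<in> Q}"
    using card_inj_on_le[OF inj sub finite_divisors] .
qed

lemma D_pow_le:
  assumes "x \<in> carrier G" "y \<in> carrier G"
  shows "\<exists>k::nat. x \<preceq> D [^] k \<otimes> y"
proof -
  obtain k :: nat where "D [^] k \<otimes> (inv x \<otimes> y) \<in> Q"
    using archimedean[of "inv x \<otimes> y"] assms by auto
  moreover have "D [^] k \<otimes> (inv x \<otimes> y) = inv x \<otimes> (D [^] k \<otimes> y)"
    using assms by (simp add: m_assoc[symmetric] D_pow_central)
  ultimately show ?thesis using assms by (auto simp: le_def)
qed

definition is_meet :: "'a \<Rightarrow> 'a set \<Rightarrow> bool" where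
  "is_meet z S \<longleftrightarrow> (\<forall>s\<in>S. z \<preceq> s) \<and> (\<forall>w. (\<forall>s\<in>S. w \<preceq> s) \<longrightarrow> w \<preceq> z)"

definition Meet :: "'a set \<Rightarrow> 'a" where
  "Meet S = (SOME z. is_meet z S)"

lemma is_meet_Meet:
  assumes "finite S" "S \<noteq> {}" "S \<subseteq> carrier G"
  shows "is_meet (Meet S) S"
proof -
  have "\<exists>z. is_meet z S"
    using assms
  proof (induction S rule: finite_ne_induct)
    case (singleton x)
    then show ?case by (auto simp: is_meet_def intro!: exI[of _ x])
  next
    case (insert x F)
    then obtain z where z: "is_meet z F" by auto
    with insert have zc: "z \<in> carrier G" "x \<in> carrier G" by (auto simp: is_meet_def)
    from meets[OF this] obtain y where "y \<in> carrier G" "y \<preceq> z" "y \<preceq> x"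
      "\<And>w. w \<preceq> z \<Longrightarrow> w \<preceq> x \<Longrightarrow> w \<preceq> y"
      using zc by (auto simp: le_def)
    then have "is_meet y (insert x F)"
      using z by (auto simp: is_meet_def intro: le_trans)
    then show ?case ..
  qed
  then show ?thesis unfolding Meet_def by (rule someI_ex)
qed

lemma Meet_le: "\<lbrakk>finite S; S \<subseteq> carrier G; s \<in> S\<rbrakk> \<Longrightarrow> Meet S \<preceq> s"
  using is_meet_Meet[of S] by (auto simp: is_meet_def)

lemma Meet_greatest: "\<lbrakk>finite S; S \<noteq> {}; \<And>s. s \<in> S \<Longrightarrow> w \<preceq> s\<rbrakk> \<Longrightarrow> w \<preceq> Meet S"
  using is_meet_Meet[of S] by (auto simp: is_meet_def)

text \<open>Left multiplication by \<open>c\<close> is an order automorphism: a lower bound of the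
  translates is pulled back by \<open>inv c\<close>, compared with the meet and pushed forward
  again.\<close>

lemma le_mult_Meet:
  assumes S: "finite S" "S \<noteq> {}" "S \<subseteq> carrier G" and c: "c \<in> carrier G"
    and le: "\<And>s. s \<in> S \<Longrightarrow> w \<preceq> c \<otimes> s"
  shows "w \<preceq> c \<otimes> Meet S"
proof -
  have wc: "w \<in> carrier G" using le S by blast
  have "inv c \<otimes> w \<preceq> s" if "s \<in> S" for s
    using le_mult_left[OF le[OF that], of "inv c"] c that S
    by (auto simp: m_assoc[symmetric] subset_eq)
  then have "inv c \<otimes> w \<preceq> Meet S" using S by (intro Meet_greatest) auto
  from le_mult_left[OF this c] show ?thesis using c wc by (simp add: m_assoc[symmetric])
qed

lemma le_mult_Meet_self:
  assumes S: "finite S" "S \<noteq> {}" "S \<subseteq> carrier G" and c: "c \<in> carrier G"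
    and le: "\<And>s. s \<in> S \<Longrightarrow> s \<preceq> c \<otimes> s"
  shows "Meet S \<preceq> c \<otimes> Meet S"
  using S c le by (intro le_mult_Meet) (auto intro: le_trans Meet_le)

section \<open>Elements with a conjugate in the positive cone\<close>

definition pos :: "'a \<Rightarrow> bool" where
  "pos h \<longleftrightarrow> h \<in> carrier G \<and> (\<exists>x. x \<preceq> h \<otimes> x)"

lemma pos_carrier [dest]: "pos h \<Longrightarrow> h \<in> carrier G"
  by (simp add: pos_def)

lemma pos_one [simp]: "pos \<one>"
  unfolding pos_def using le_refl[OF one_closed] by (intro conjI exI[of _ \<one>]) auto

lemma pos_conj:
  assumes "pos h" "z \<in> carrier G"
  shows "pos (z \<otimes> h \<otimes> inv z)"
proof -
  obtain x where x: "x \<preceq> h \<otimes> x" using assms by (auto simp: pos_def)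
  then have "z \<otimes> x \<preceq> (z \<otimes> h \<otimes> inv z) \<otimes> (z \<otimes> x)"
    using le_mult_left[OF x assms(2)] assms pos_carrier[OF assms(1)] by (auto simp: m_assoc dest: leD)
  then show ?thesis using assms unfolding pos_def by blast
qed

lemma pos_D_pow:
  assumes "a \<in> carrier G"
  shows "\<exists>k::nat. pos (D [^] k \<otimes> a)"
proof -
  obtain k :: nat where "\<one> \<preceq> D [^] k \<otimes> a" using D_pow_le[OF one_closed assms] by auto
  then have "\<one> \<preceq> (D [^] k \<otimes> a) \<otimes> \<one>" using assms by simp
  then have "pos (D [^] k \<otimes> a)"
    unfolding pos_def using assms by (intro conjI exI[of _ \<one>]) auto
  then show ?thesis ..
qed

lemma pos_D_pow_mono:
  assumes "pos (D [^] (k::nat) \<otimes> a)" "a \<in> carrier G" "k \<le> l"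
  shows "pos (D [^] l \<otimes> a)"
proof -
  obtain x where x: "x \<preceq> D [^] k \<otimes> a \<otimes> x" using assms by (auto simp: pos_def)
  then have xc: "x \<in> carrier G" by auto
  have "D [^] k \<otimes> a \<otimes> x \<preceq> D [^] (l - k) \<otimes> (D [^] k \<otimes> a \<otimes> x)"
    using assms xc by (intro le_D_pow_mult) auto
  also have "\<dots> = (D [^] (l - k) \<otimes> D [^] k) \<otimes> a \<otimes> x"
    using assms xc by (simp add: m_assoc)
  also have "D [^] (l - k) \<otimes> D [^] k = D [^] l"
    using assms by (simp add: nat_pow_mult)
  finally have "x \<preceq> D [^] l \<otimes> a \<otimes> x" using x le_trans by blast
  then show ?thesis using assms unfolding pos_def by auto
qed

text \<open>The partial meets of the orbit \<open>h\<^sup>i x\<close> descend and are bounded below by an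
  element \<open>z \<preceq> h z\<close>, so they become stationary. The form of \<open>S\<close> keeps the inequalities
  \<open>x \<preceq> s x\<close> for \<open>s\<close> commuting with \<open>h\<close>.\<close>
lemma common_fixed_point_step:
  assumes h: "pos h" and x: "x \<in> carrier G"
  obtains S where "finite S" "S \<noteq> {}" "S \<subseteq> (\<lambda>i::nat. h [^] i \<otimes> x) ` UNIV"
    "Meet S \<preceq> h \<otimes> Meet S"
proof -
  have hc: "h \<in> carrier G" using h by auto
  obtain z0 where z0: "z0 \<preceq> h \<otimes> z0" using h by (auto simp: pos_def)
  then have z0c: "z0 \<in> carrier G" by auto
  obtain m :: nat where m: "z0 \<preceq> D [^] m \<otimes> x" using D_pow_le[OF z0c x] by auto
  \<comment> \<open>\<open>D\<close> is central, so a negative power of it moves the witness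
    \<open>z0\<close> below \<open>x\<close> and keeps the inequality for \<open>h\<close>.\<close>
  define z where "z = inv (D [^] m) \<otimes> z0"
  have zc: "z \<in> carrier G" using z0c by (simp add: z_def)
  have z: "z \<preceq> h \<otimes> z"
  proof -
    have "inv (D [^] m) \<otimes> h = h \<otimes> inv (D [^] m)"
      using hc by (metis D_pow_central inv_closed inv_inv inv_mult_group nat_pow_closed D_carrier)
    then have "inv (D [^] m) \<otimes> (h \<otimes> z0) = h \<otimes> z"
      using hc z0c by (simp add: z_def m_assoc[symmetric])
    then show ?thesis using le_mult_left[OF z0, of "inv (D [^] m)"] by (simp add: z_def)
  qed
  have zx: "z \<preceq> x"
    using le_mult_left[OF m, of "inv (D [^] m)"] x by (simp add: z_def m_assoc[symmetric])
  have zh: "z \<preceq> h [^] i \<otimes> z" for i :: nat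
  proof (induction i)
    case (Suc i)
    have "h [^] i \<otimes> z \<preceq> h [^] i \<otimes> (h \<otimes> z)" using z hc by (intro le_mult_left) auto
    then show ?case using Suc hc zc by (auto simp: m_assoc intro: le_trans)
  qed (use zc in simp)
  define F where "F i = h [^] i \<otimes> x" for i :: nat
  define y where "y k = Meet (F ` {..k})" for k
  have F: "F i \<in> carrier G" "z \<preceq> F i" for i
    using le_trans[OF zh le_mult_left[OF zx]] hc x by (auto simp: F_def)
  have yle: "y k \<preceq> F i" if "i \<le> k" for i k
    unfolding y_def using F that by (intro Meet_le) auto
  have zy: "z \<preceq> y k" for k unfolding y_def using F by (intro Meet_greatest) auto
  have mono: "y l \<preceq> y k" if "k \<le> l" for k l
    unfolding y_def[of k] using that by (intro Meet_greatest) (auto intro: yle)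
  \<comment> \<open>Every \<open>y k\<close> lies between \<open>z\<close> and \<open>x\<close>;
    this bound on \<open>x\<close> confines the whole sequence to one finite interval.\<close>
  obtain c :: nat where c: "x \<preceq> D [^] c \<otimes> z" using D_pow_le[OF x zc] by auto
  have "y k \<in> {w. z \<preceq> w \<and> w \<preceq> D [^] c \<otimes> z}" for k
    using zy le_trans[OF yle[of 0 k] , of "D [^] c \<otimes> z"] c x by (simp add: F_def)
  then have "range y \<subseteq> {w. z \<preceq> w \<and> w \<preceq> D [^] c \<otimes> z}" by blast
  then have "finite (range y)" by (rule finite_subset) (rule finite_interval(1)[OF zc])
  then have "\<not> inj y" using range_inj_infinite by blast
  then obtain i j where ij: "i < j" "y i = y j"
    unfolding inj_def by (metis linorder_neqE_nat)
  \<comment> \<open>In a descending sequence the repetition makes \<open>y i\<close> a lower bound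
    of \<open>F (Suc i)\<close> too, hence of the \<open>h\<close>-translates of all points whose
    meet it is.\<close>
  then have "y i \<preceq> y (Suc i)" using mono[of "Suc i" j] by simp
  then have "y i \<preceq> h \<otimes> y i"
    unfolding y_def[of i] using F hc
  proof (intro le_mult_Meet)
    fix s assume "s \<in> F ` {..i}"
    then obtain l where l: "l \<le> i" "s = F l" by auto
    have "h \<otimes> s = F (Suc l)" unfolding l F_def using nat_pow_Suc2[OF hc, of l] hc x by (simp add: m_assoc[symmetric])
    moreover have "y (Suc i) \<preceq> F (Suc l)" using yle l by simp
    ultimately show "Meet (F ` {..i}) \<preceq> h \<otimes> s"
      using \<open>y i \<preceq> y (Suc i)\<close> by (auto simp: y_def intro: le_trans)
  qed auto
  then show ?thesis using that[of "F ` {..i}"] by (auto simp: F_def y_def)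
qed

text \<open>Multiplication by \<open>u\<close> sends each of the points
  \<open>u [^] i \<otimes> x\<close> with \<open>i < j\<close> to another of them or, at the last
  one, to an element above \<open>x\<close>. Their meet therefore lies below its own
  \<open>u\<close>-translate.\<close>

lemma pos_root:
  assumes u: "u \<in> carrier G" and "pos (u [^] (j::nat))" and j: "0 < j"
  shows "pos u"
proof -
  obtain x where x: "x \<preceq> u [^] j \<otimes> x" using assms by (auto simp: pos_def)
  then have xc: "x \<in> carrier G" by auto
  define S where "S = (\<lambda>i. u [^] i \<otimes> x) ` {..<j}"
  have S: "finite S" "S \<noteq> {}" "S \<subseteq> carrier G" using j u xc by (auto simp: S_def)
  have "Meet S \<preceq> u \<otimes> s" if s: "s \<in> S" for s
  proof -
    obtain i where i: "i < j" "s = u [^] i \<otimes> x" using s by (auto simp: S_def)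
    have us: "u \<otimes> s = u [^] Suc i \<otimes> x"
      unfolding i using nat_pow_Suc2[OF u, of i] u xc by (simp add: m_assoc)
    show ?thesis
    proof (cases "Suc i < j")
      case True
      then have "u [^] Suc i \<otimes> x \<in> S" unfolding S_def by blast
      then show ?thesis unfolding us using S by (intro Meet_le)
    next
      case False
      then have ij: "Suc i = j" using i by simp
      have "x \<in> S" using j xc by (auto simp: S_def image_iff intro!: bexI[of _ 0])
      then have "Meet S \<preceq> x" using S by (intro Meet_le)
      then show ?thesis unfolding us ij using x le_trans by blast
    qed
  qed
  then have "Meet S \<preceq> u \<otimes> Meet S" using S u by (intro le_mult_Meet)
  then show ?thesis using u by (auto simp: pos_def)
qed

end

subsection \<open>Commuting elements\<close>

locale garside_abelian = garside_order +
  fixes A :: "'a set"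
  assumes A_subgroup: "subgroup A G"
    and A_comm: "\<lbrakk>a \<in> A; b \<in> A\<rbrakk> \<Longrightarrow> a \<otimes> b = b \<otimes> a"
    and D_A: "D \<in> A"
begin

lemma A_carrier [simp, intro]: "a \<in> A \<Longrightarrow> a \<in> carrier G"
  using subgroup.mem_carrier[OF A_subgroup] .

lemma A_one [simp, intro]: "\<one> \<in> A"
  and A_mult [simp, intro]: "a \<in> A \<Longrightarrow> b \<in> A \<Longrightarrow> a \<otimes> b \<in> A"
  and A_inv [simp, intro]: "a \<in> A \<Longrightarrow> inv a \<in> A"
  and A_int_pow [simp, intro]: "a \<in> A \<Longrightarrow> a [^] (i::int) \<in> A"
  and A_nat_pow [simp, intro]: "a \<in> A \<Longrightarrow> a [^] (n::nat) \<in> A"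
  using subgroup.one_closed[OF A_subgroup] subgroup.m_closed[OF A_subgroup]
    subgroup.m_inv_closed[OF A_subgroup] subgroup_int_pow_closed[OF A_subgroup, of a i]
    subgroup_int_pow_closed[OF A_subgroup, of a "int n"]
  by (auto simp: int_pow_int)

lemma A_lcomm: "\<lbrakk>a \<in> A; b \<in> A; x \<in> carrier G\<rbrakk> \<Longrightarrow> a \<otimes> (b \<otimes> x) = b \<otimes> (a \<otimes> x)"
  using A_comm[of a b] by (simp add: m_assoc[symmetric])

lemma A_left_comm: "\<lbrakk>a \<in> A; b \<in> A; c \<in> A\<rbrakk> \<Longrightarrow> a \<otimes> (b \<otimes> c) = b \<otimes> (a \<otimes> c)"
  by (simp add: A_lcomm)

lemmas A_ac = m_assoc A_comm A_left_comm

text \<open>Elements are treated one at a time. Passing from \<open>x\<close> to a meet of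
  translates \<open>h [^] i \<otimes> x\<close> gains the inequality for \<open>h\<close>; those for
  \<open>F\<close> survive because \<open>F\<close> commutes with \<open>h\<close>.\<close>

lemma common_fixed_point:
  assumes "finite S" "S \<subseteq> A" "\<And>s. s \<in> S \<Longrightarrow> pos s"
  shows "\<exists>x\<in>carrier G. \<forall>s\<in>S. x \<preceq> s \<otimes> x"
  using assms
proof (induction S rule: finite_induct)
  case (insert h F)
  then obtain x where x: "x \<in> carrier G" "\<And>s. s \<in> F \<Longrightarrow> x \<preceq> s \<otimes> x" by auto
  have hA: "h \<in> A" using insert by auto
  from insert have "pos h" by auto
  then obtain S where S: "finite S" "S \<noteq> {}" "S \<subseteq> (\<lambda>i::nat. h [^] i \<otimes> x) ` UNIV"
    "Meet S \<preceq> h \<otimes> Meet S"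
    using common_fixed_point_step[OF _ x(1)] by blast
  have "Meet S \<preceq> s \<otimes> Meet S" if s: "s \<in> F" for s
  proof (rule le_mult_Meet_self)
    show "S \<subseteq> carrier G" using S hA x by auto
    have sA: "s \<in> A" using insert s by auto
    then show "s \<in> carrier G" by auto
    fix t assume "t \<in> S"
    then obtain i :: nat where t: "t = h [^] i \<otimes> x" using S by auto
    show "t \<preceq> s \<otimes> t"
      using le_mult_left[OF x(2)[OF s], of "h [^] i"] hA sA x
      by (simp add: t A_lcomm[of _ s])
  qed (use S in auto)
  then show ?case using S by auto
qed (use one_closed in auto)

lemma pos_mult:
  assumes "a \<in> A" "b \<in> A" "pos a" "pos b"
  shows "pos (a \<otimes> b)"
proof -
  obtain x where x: "x \<in> carrier G" "x \<preceq> a \<otimes> x" "x \<preceq> b \<otimes> x"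
    using common_fixed_point[of "{a, b}"] assms by auto
  then have "a \<otimes> x \<preceq> a \<otimes> (b \<otimes> x)" using assms by (intro le_mult_left) auto
  then have "x \<preceq> (a \<otimes> b) \<otimes> x" using x assms le_trans by (auto simp: m_assoc)
  then show ?thesis using assms unfolding pos_def by auto
qed

lemma pos_pow: "\<lbrakk>a \<in> A; pos a\<rbrakk> \<Longrightarrow> pos (a [^] (n::nat))"
  by (induction n) (auto intro: pos_mult)

text \<open>The witnesses for \<open>a\<close> and \<open>inv a\<close> may differ; at a common one,
  the two inequalities become \<open>x \<preceq> a \<otimes> x\<close> and
  \<open>a \<otimes> x \<preceq> x\<close>.\<close>

lemma pos_antisym:
  assumes "a \<in> A" "pos a" "pos (inv a)"
  shows "a = \<one>"
proof -
  obtain x where x: "x \<in> carrier G" "x \<preceq> a \<otimes> x" "x \<preceq> inv a \<otimes> x"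
    using common_fixed_point[of "{a, inv a}"] assms by auto
  have "a \<otimes> x \<preceq> x" using le_mult_left[OF x(3), of a] x assms by simp
  then have "a \<otimes> x = x" using x le_antisym by blast
  then show ?thesis using assms x by (metis A_carrier r_cancel_one)
qed

text \<open>The quotient of two \<open>q\<close>-th roots has \<open>q\<close>-th power one, so by
  \<open>pos_root\<close> it and its inverse are both positive. This is torsion-freeness of
  \<open>A\<close>.\<close>

lemma root_unique:
  assumes "a \<in> A" "b \<in> A" "a [^] (q::nat) = b [^] q" "0 < q"
  shows "a = b"
proof -
  define u where "u = a \<otimes> inv b"
  have u: "u \<in> A" using assms by (simp add: u_def)
  have "u [^] q = a [^] q \<otimes> inv b [^] q"
    unfolding u_def using assms by (intro pow_mult_distrib) (auto intro: A_comm)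
  also have "\<dots> = \<one>" using assms by (simp add: nat_pow_inv)
  finally have 1: "u [^] q = \<one>" .
  then have "inv u [^] q = \<one>" using u by (simp add: nat_pow_inv)
  with 1 have "pos u" "pos (inv u)"
    using u assms pos_root[of u q] pos_root[of "inv u" q] by auto
  then have "u = \<one>" using u pos_antisym by blast
  then show ?thesis using assms unfolding u_def by (metis A_carrier inv_closed inv_equality inv_inv)
qed

lemma le_pow_mult:
  assumes "a \<in> A" "x \<preceq> a \<otimes> x"
  shows "x \<preceq> a [^] (n::nat) \<otimes> x"
proof (induction n)
  case (Suc n)
  have "a [^] n \<otimes> x \<preceq> a [^] n \<otimes> (a \<otimes> x)" using assms by (intro le_mult_left) auto
  also have "\<dots> = a [^] Suc n \<otimes> x" using assms by (auto simp: m_assoc)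
  finally show ?case using Suc le_trans by blast
qed (use assms in auto)

section \<open>Dominance and the length of strict chains\<close>

definition dominated :: "'a \<Rightarrow> 'a \<Rightarrow> bool" (infix "\<unlhd>" 50) where
  "a \<unlhd> b \<longleftrightarrow> (\<exists>k::nat. pos (b [^] k \<otimes> inv a))"

definition sdominated :: "'a \<Rightarrow> 'a \<Rightarrow> bool" (infix "\<lhd>\<lhd>" 50) where
  "a \<lhd>\<lhd> b \<longleftrightarrow> a \<unlhd> b \<and> \<not> b \<unlhd> a"

text \<open>Garside property of the dominance relation: domination inside the unit interval
  \<open>[D\<inverse> x, x]\<close> propagates to all \<open>y \<preceq> x\<close>.\<close>
lemma le_absorb:
  assumes f: "f \<in> A" and h: "h \<in> A" and x: "x \<preceq> f \<otimes> x" "x \<preceq> h \<otimes> x"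
    and unit: "\<And>w l. \<lbrakk>w \<preceq> x; x \<preceq> D \<otimes> w; x \<preceq> h [^] (l::nat) \<otimes> w\<rbrakk> \<Longrightarrow> \<exists>m::nat. x \<preceq> f [^] m \<otimes> w"
    and y: "y \<preceq> x" "x \<preceq> D [^] (k::nat) \<otimes> y" "x \<preceq> h [^] (l::nat) \<otimes> y"
  shows "\<exists>m::nat. x \<preceq> f [^] m \<otimes> y"
  using y
proof (induction k arbitrary: y)
  case 0
  then have "y = x" using le_antisym leD(1)[of y x] by auto
  then show ?case using 0 by (intro exI[of _ 0]) auto
next
  case (Suc k)
  have xc: "x \<in> carrier G" and yc: "y \<in> carrier G" using Suc x by auto
  have xD: "x \<preceq> D \<otimes> x" using le_D_pow_mult[OF xc, of 1] by simp
  have xh: "x \<preceq> h [^] l \<otimes> x" using le_pow_mult h x by blast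
  have comm: "a \<otimes> (b \<otimes> y) = b \<otimes> (a \<otimes> y)" if "a \<in> A" "b \<in> A" for a b
    using that yc by (rule A_lcomm)
  \<comment> \<open>Moving \<open>y\<close> up by one factor \<open>D\<close>, cut off at
    \<open>x\<close>, lowers the distance to \<open>x\<close> from \<open>Suc k\<close> to
    \<open>k\<close>, so the induction hypothesis applies to \<open>w\<close>.\<close>
  define w where "w = Meet {D \<otimes> y, x}"
  have S: "finite {D \<otimes> y, x}" "{D \<otimes> y, x} \<noteq> {}" "{D \<otimes> y, x} \<subseteq> carrier G"
    using xc yc by auto
  have "w \<preceq> x" "w \<preceq> D \<otimes> y" unfolding w_def using S by (auto intro: Meet_le)
  have "x \<preceq> D [^] k \<otimes> w" unfolding w_def using S
    by (rule le_mult_Meet) (use Suc xc yc le_D_pow_mult in \<open>auto simp: m_assoc\<close>)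
  moreover have "x \<preceq> h [^] l \<otimes> w" unfolding w_def using S
  proof (rule le_mult_Meet)
    have "D \<otimes> x \<preceq> D \<otimes> (h [^] l \<otimes> y)" using Suc by (intro le_mult_left) auto
    then have "x \<preceq> h [^] l \<otimes> (D \<otimes> y)" using xD comm[of D "h [^] l"] h D_A le_trans by simp
    then show "x \<preceq> h [^] l \<otimes> s" if "s \<in> {D \<otimes> y, x}" for s using that xh by auto
  qed (use h in auto)
  ultimately obtain m :: nat where "x \<preceq> f [^] m \<otimes> w" using Suc.IH \<open>w \<preceq> x\<close> by blast
  also have "f [^] m \<otimes> w \<preceq> f [^] m \<otimes> (D \<otimes> y)"
    using \<open>w \<preceq> D \<otimes> y\<close> f by (intro le_mult_left) auto
  finally have m: "x \<preceq> D \<otimes> (f [^] m \<otimes> y)" using comm[of "f [^] m" D] f D_A by simp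
  \<comment> \<open>Now \<open>f [^] m \<otimes> y\<close> is within one factor \<open>D\<close> of
    \<open>x\<close>. Its meet with \<open>x\<close> lies in the unit interval, where
    \<open>unit\<close> supplies the remaining power of \<open>f\<close>.\<close>
  define v where "v = Meet {f [^] m \<otimes> y, x}"
  have T: "finite {f [^] m \<otimes> y, x}" "{f [^] m \<otimes> y, x} \<noteq> {}" "{f [^] m \<otimes> y, x} \<subseteq> carrier G"
    using xc yc f by auto
  have v: "v \<preceq> x" "v \<preceq> f [^] m \<otimes> y" unfolding v_def using T by (auto intro: Meet_le)
  have "x \<preceq> D \<otimes> v" unfolding v_def using T
    by (rule le_mult_Meet) (use m xD in auto)
  moreover have "x \<preceq> h [^] l \<otimes> v" unfolding v_def using T
  proof (rule le_mult_Meet)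
    have "f [^] m \<otimes> x \<preceq> f [^] m \<otimes> (h [^] l \<otimes> y)" using Suc f by (intro le_mult_left) auto
    then have "x \<preceq> h [^] l \<otimes> (f [^] m \<otimes> y)"
      using le_pow_mult[OF f x(1), of m] comm[of "f [^] m" "h [^] l"] f h le_trans by simp
    then show "x \<preceq> h [^] l \<otimes> s" if "s \<in> {f [^] m \<otimes> y, x}" for s using that xh by auto
  qed (use h in auto)
  ultimately obtain n :: nat where "x \<preceq> f [^] n \<otimes> v" using unit v by blast
  also have "f [^] n \<otimes> v \<preceq> f [^] n \<otimes> (f [^] m \<otimes> y)" using v f by (intro le_mult_left) auto
  also have "\<dots> = f [^] (n + m) \<otimes> y"
    using f yc by (simp add: m_assoc[symmetric] nat_pow_mult)
  finally show ?case by blast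
qed

text \<open>At a base point \<open>x\<close> common to the whole chain, \<open>E i\<close> collects
  the elements of the unit interval below \<open>x\<close> that some power of \<open>g i\<close>
  lifts above \<open>x\<close>. These sets grow by dominance, and strictly so: by
  \<open>le_absorb\<close>, equality would give the reverse dominance. Hence the chain is no longer
  than the interval is large.\<close>

lemma sdominated_chain_bound:
  assumes g: "\<And>i. i \<le> d \<Longrightarrow> g i \<in> A" "\<And>i. i \<le> d \<Longrightarrow> pos (g i)"
    and chain: "\<And>i. i < d \<Longrightarrow> g i \<lhd>\<lhd> g (Suc i)"
  shows "d \<le> card {m \<in> Q. inv m \<otimes> D [^] (1::nat) \<in> Q}"
proof -
  have "\<forall>i\<in>{..<d}. \<exists>k::nat. pos (g (Suc i) [^] k \<otimes> inv (g i))"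
    using chain by (auto simp: sdominated_def dominated_def)
  then obtain k :: "nat \<Rightarrow> nat" where k: "\<And>i. i < d \<Longrightarrow> pos (g (Suc i) [^] k i \<otimes> inv (g i))"
    unfolding bchoice_iff by auto
  have "\<exists>x\<in>carrier G. \<forall>s\<in>g ` {..d} \<union> (\<lambda>i. g (Suc i) [^] k i \<otimes> inv (g i)) ` {..<d}. x \<preceq> s \<otimes> x"
    using g k by (intro common_fixed_point) auto
  then obtain x where xc: "x \<in> carrier G" and x: "\<And>i. i \<le> d \<Longrightarrow> x \<preceq> g i \<otimes> x"
    "\<And>i. i < d \<Longrightarrow> x \<preceq> (g (Suc i) [^] k i \<otimes> inv (g i)) \<otimes> x"
    by auto
  define E where "E i = {w. w \<preceq> x \<and> x \<preceq> D \<otimes> w \<and> (\<exists>l::nat. x \<preceq> g i [^] l \<otimes> w)}" for i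
  define y where "y = inv D \<otimes> x"
  let ?I = "{w. y \<preceq> w \<and> w \<preceq> D [^] (1::nat) \<otimes> y}"
  have yc: "y \<in> carrier G" and Dy: "D \<otimes> y = x" using xc by (auto simp: y_def)
  have EI: "E i \<subseteq> ?I" for i
  proof
    fix w assume w: "w \<in> E i"
    then have "inv D \<otimes> x \<preceq> inv D \<otimes> (D \<otimes> w)" by (intro le_mult_left) (auto simp: E_def)
    with w show "w \<in> ?I" using Dy by (auto simp: E_def y_def leD)
  qed
  have finE: "finite (E i)" for i
    using EI finite_interval(1)[OF yc, of 1] by (rule finite_subset)
  have mono: "E i \<subset> E (Suc i)" if i: "i < d" for i
  proof
    have gA: "g i \<in> A" "g (Suc i) \<in> A" using g i by auto
    define u where "u = g (Suc i) [^] k i \<otimes> inv (g i)"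
    have uA: "u \<in> A" using gA by (simp add: u_def)
    show "E i \<subseteq> E (Suc i)"
    proof
      fix w assume w: "w \<in> E i"
      then obtain l :: nat where l: "x \<preceq> g i [^] l \<otimes> w" by (auto simp: E_def)
      then have wc: "w \<in> carrier G" using w by (auto simp: E_def)
      have "x \<preceq> u [^] l \<otimes> x" using le_pow_mult[OF uA] x(2)[OF i] by (simp add: u_def)
      also have "u [^] l \<otimes> x \<preceq> u [^] l \<otimes> (g i [^] l \<otimes> w)" using l uA by (intro le_mult_left) auto
      also have "\<dots> = (u [^] l \<otimes> g i [^] l) \<otimes> w" using uA gA wc by (simp add: m_assoc)
      also have "u [^] l \<otimes> g i [^] l = (u \<otimes> g i) [^] l"
        using uA gA by (intro pow_mult_distrib[symmetric]) (auto intro: A_comm)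
      also have "u \<otimes> g i = g (Suc i) [^] k i" using gA by (simp add: u_def m_assoc)
      finally have "x \<preceq> g (Suc i) [^] (k i * l) \<otimes> w" using gA by (simp add: nat_pow_pow)
      then show "w \<in> E (Suc i)" using w by (auto simp: E_def)
    qed
    show "E i \<noteq> E (Suc i)"
    proof
      assume eq: "E i = E (Suc i)"
      \<comment> \<open>The first power of \<open>g (Suc i)\<close> lifts \<open>z\<close> exactly
        to \<open>x\<close>. A power of \<open>g i\<close> lifting \<open>z\<close> above
        \<open>x\<close> says precisely that \<open>g i\<close> dominates
        \<open>g (Suc i)\<close>.\<close>
      define z where "z = inv (g (Suc i)) \<otimes> x"
      have zc: "z \<in> carrier G" using gA xc by (simp add: z_def)
      have z: "z \<preceq> x" using le_mult_left[OF x(1)[of "Suc i"], of "inv (g (Suc i))"] i gA xc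
        by (simp add: z_def)
      obtain n :: nat where n: "x \<preceq> D [^] n \<otimes> z" using D_pow_le[OF xc zc] by auto
      have "\<exists>m::nat. x \<preceq> g i [^] m \<otimes> z"
      proof (rule le_absorb[OF gA])
        fix w and l :: nat
        assume "w \<preceq> x" "x \<preceq> D \<otimes> w" "x \<preceq> g (Suc i) [^] l \<otimes> w"
        then have "w \<in> E (Suc i)" by (auto simp: E_def)
        then show "\<exists>m::nat. x \<preceq> g i [^] m \<otimes> w" using eq by (auto simp: E_def)
      next
        show "x \<preceq> g (Suc i) [^] (1::nat) \<otimes> z" using gA xc by (simp add: z_def)
      qed (use x i z n in auto)
      then obtain m :: nat where "x \<preceq> (g i [^] m \<otimes> inv (g (Suc i))) \<otimes> x"
        using gA xc by (auto simp: z_def m_assoc)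
      then have "g (Suc i) \<unlhd> g i" using gA unfolding dominated_def pos_def by auto
      then show False using chain[OF i] by (simp add: sdominated_def)
    qed
  qed
  have "i \<le> card (E i)" if "i \<le> d" for i
    using that
  proof (induction i)
    case (Suc i)
    then have "card (E i) < card (E (Suc i))" using mono finE by (intro psubset_card_mono) auto
    then show ?case using Suc by simp
  qed simp
  then have "d \<le> card (E d)" by simp
  also have "\<dots> \<le> card ?I" using EI finite_interval(1)[OF yc, of 1] by (intro card_mono) auto
  also have "\<dots> \<le> card {m \<in> Q. inv m \<otimes> D [^] (1::nat) \<in> Q}" by (rule finite_interval(2)[OF yc])
  finally show ?thesis .
qed

subsection \<open>Rationality of slopes\<close>

text \<open>Monomials turn positivity and dominance into arithmetic of exponents. The slope of
  \<open>h\<close> against \<open>g\<close> is read from the first two exponents; the third records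
  how much of \<open>f\<close> is conceded.\<close>

definition mon :: "'a \<Rightarrow> 'a \<Rightarrow> 'a \<Rightarrow> int \<Rightarrow> int \<Rightarrow> int \<Rightarrow> 'a" where
  "mon h g f i j k = h [^] i \<otimes> (g [^] j \<otimes> f [^] k)"

context
  fixes h g f :: 'a
  assumes gens [simp]: "h \<in> A" "g \<in> A" "f \<in> A"
begin

lemma mon_A [simp]: "mon h g f i j k \<in> A"
  by (simp add: mon_def)

lemma mon_carrier [simp]: "mon h g f i j k \<in> carrier G"
  by (intro A_carrier mon_A)

lemma mon_mult: "mon h g f i j k \<otimes> mon h g f i' j' k' = mon h g f (i + i') (j + j') (k + k')"
  by (simp add: mon_def int_pow_mult A_ac)

lemma mon_act:
  "x \<in> carrier G \<Longrightarrow>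
    mon h g f i j k \<otimes> (mon h g f i' j' k' \<otimes> x) = mon h g f (i + i') (j + j') (k + k') \<otimes> x"
  by (simp add: m_assoc[symmetric] mon_mult)

lemma mon_unit: "mon h g f 0 0 0 = \<one>" "mon h g f 1 0 0 = h" "mon h g f 0 1 0 = g"
    "mon h g f 0 0 1 = f"
  by (simp_all add: mon_def)

lemma mon_inv: "inv (mon h g f i j k) = mon h g f (- i) (- j) (- k)"
  by (rule inv_equality) (simp_all add: mon_mult mon_unit)

lemma mon_pow: "mon h g f i j k [^] (n::nat) = mon h g f (int n * i) (int n * j) (int n * k)"
  by (induction n) (simp_all add: mon_unit mon_mult algebra_simps)

lemma mon_le_mono:
  assumes "x \<preceq> g \<otimes> x" "x \<preceq> f \<otimes> x" "j \<le> j'" "k \<le> k'"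
  shows "mon h g f i j k \<otimes> x \<preceq> mon h g f i j' k' \<otimes> x"
proof -
  have xc: "x \<in> carrier G" using assms by auto
  have "x \<preceq> g [^] nat (j' - j) \<otimes> x" using assms by (intro le_pow_mult) auto
  also have "\<dots> \<preceq> g [^] nat (j' - j) \<otimes> (f [^] nat (k' - k) \<otimes> x)"
    using assms by (intro le_mult_left le_pow_mult) auto
  also have "\<dots> = mon h g f 0 (j' - j) (k' - k) \<otimes> x"
    using assms xc by (simp add: mon_def m_assoc int_pow_int[symmetric])
  finally have "mon h g f i j k \<otimes> x \<preceq> mon h g f i j k \<otimes> (mon h g f 0 (j' - j) (k' - k) \<otimes> x)"
    by (intro le_mult_left) auto
  then show ?thesis using xc by (simp add: mon_act)
qed

text \<open>With \<open>aq - pb = -1\<close>, the meets \<open>w j\<close> of the translates \<open>h\<^sup>i g\<^sup>s x\<close> with \<open>i \<ge> 0\<close>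
  and \<open>ai + bs \<ge> j\<close> form a chain \<open>w 0 \<preceq> \<dots> \<preceq> w b\<close> in an interval with fewer than
  \<open>b + 1\<close> elements, so two consecutive ones agree. (Modulo \<open>h\<^sup>b g\<^sup>-\<^sup>a f\<^sup>k\<close> the range
  \<open>0 \<le> i < b\<close> suffices.)\<close>
lemma slope_step_coprime:
  fixes b k :: nat and a :: int
  assumes pos_gf: "pos g" "pos f" and c: "pos (D [^] (c::nat) \<otimes> inv g)"
    and u: "pos (mon h g f (int b) (- a) (int k))"
    and b: "card {m \<in> Q. inv m \<otimes> D [^] c \<in> Q} < b"
    and bezout: "a * int q + 1 = p * int b"
  shows "pos (mon h g f (int q) (- p) (int (q * k)))"
proof -
  let ?E = "mon h g f"
  have "\<exists>x\<in>carrier G. \<forall>s\<in>{g, f, D [^] c \<otimes> inv g, ?E (int b) (- a) (int k)}. x \<preceq> s \<otimes> x"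
    using pos_gf c u D_A by (intro common_fixed_point) auto
  then obtain x where xc: "x \<in> carrier G" and xg: "x \<preceq> g \<otimes> x" and xf: "x \<preceq> f \<otimes> x"
    and xD: "x \<preceq> D [^] c \<otimes> inv g \<otimes> x" and xu: "x \<preceq> ?E (int b) (- a) (int k) \<otimes> x"
    by auto
  have b0: "0 < b" using b by simp
  \<comment> \<open>The exponent of \<open>g\<close> is the least \<open>s\<close> with
    \<open>a * int i + int b * s \<ge> j\<close>, so \<open>F j i\<close> is the lowest translate at
    level \<open>j\<close> with this power of \<open>h\<close>.\<close>
  define F where "F j i = ?E (int i) (- ((a * int i - j) div int b)) 0 \<otimes> x" for j :: int and i :: nat
  define w where "w j = Meet (F j ` {..<b})" for j :: int
  have F: "finite (F j ` {..<b})" "F j ` {..<b} \<noteq> {}" "F j ` {..<b} \<subseteq> carrier G" for j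
    using b0 xc by (auto simp: F_def)
  have Fc: "F j i \<in> carrier G" for j i using xc by (simp add: F_def)
  have wF: "w j \<preceq> F j i" if "i < b" for j i
    unfolding w_def using F that by (intro Meet_le) auto
  \<comment> \<open>A factor \<open>h\<close> raises the level by \<open>a\<close>. The factor
    \<open>f [^] k\<close> pays for the one case in which the exponent of \<open>h\<close> reaches
    \<open>b\<close>.\<close>
  have step: "w (j + a) \<preceq> ?E 1 0 (int k) \<otimes> w j" for j
    unfolding w_def[of j] using F
  proof (rule le_mult_Meet)
    fix s assume "s \<in> F j ` {..<b}"
    then obtain i where i: "i < b" "s = F j i" by auto
    have s: "?E 1 0 (int k) \<otimes> s = ?E (int (Suc i)) (- ((a * int i - j) div int b)) (int k) \<otimes> x"
      using xc by (simp add: i F_def mon_act add.commute)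
    show "w (j + a) \<preceq> ?E 1 0 (int k) \<otimes> s"
    proof (cases "Suc i < b")
      case True
      have "F (j + a) (Suc i) = ?E (int (Suc i)) (- ((a * int i - j) div int b)) 0 \<otimes> x"
        by (simp add: F_def algebra_simps)
      also have "\<dots> \<preceq> ?E 1 0 (int k) \<otimes> s"
        unfolding s using xg xf by (intro mon_le_mono) auto
      finally show ?thesis using wF[OF True] le_trans by blast
    next
      case False
      \<comment> \<open>The exponent of \<open>h\<close> would become \<open>b\<close>;
        \<open>xu\<close> compares that translate with one in which \<open>h [^] b\<close> is traded
        for \<open>g [^] a\<close> at the price of \<open>f [^] k\<close>, returning to exponent
        zero.\<close>
      then have ib: "int i = int b - 1" using i by simp
      have "a * int i - j = (- a - j) + a * int b" by (simp add: ib algebra_simps)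
      then have div: "(a * int i - j) div int b = (- a - j) div int b + a"
        using b0 by (metis div_mult_self1 add.commute less_not_refl of_nat_eq_0_iff)
      have "F (j + a) 0 = ?E 0 (- ((- a - j) div int b)) 0 \<otimes> x"
        by (simp add: F_def algebra_simps)
      also have "\<dots> \<preceq> ?E 0 (- ((- a - j) div int b)) 0 \<otimes> (?E (int b) (- a) (int k) \<otimes> x)"
        using xu by (intro le_mult_left) auto
      also have "\<dots> = ?E 1 0 (int k) \<otimes> s"
        unfolding s div using xc ib by (simp add: mon_act algebra_simps)
      finally show ?thesis using wF[OF b0] le_trans by blast
    qed
  qed auto
  have steps: "w (j + int n * a) \<preceq> ?E (int n) 0 (int (n * k)) \<otimes> w j" for j and n :: nat
  proof (induction n)
    case 0
    have "w j \<in> carrier G" using wF[OF b0] by auto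
    then show ?case by (simp add: mon_unit)
  next
    case (Suc n)
    have wc: "w j \<in> carrier G" using wF[OF b0] by auto
    have "w (j + int (Suc n) * a) = w ((j + int n * a) + a)" by (simp add: algebra_simps)
    also have "\<dots> \<preceq> ?E 1 0 (int k) \<otimes> w (j + int n * a)" by (rule step)
    also have "\<dots> \<preceq> ?E 1 0 (int k) \<otimes> (?E (int n) 0 (int (n * k)) \<otimes> w j)"
      by (intro le_mult_left Suc) auto
    finally show ?case using wc by (simp add: mon_act algebra_simps)
  qed
  have shift: "w (j - p * int b) \<preceq> ?E 0 (- p) 0 \<otimes> w j" for j
    unfolding w_def[of j] using F
  proof (rule le_mult_Meet)
    fix s assume "s \<in> F j ` {..<b}"
    then obtain i where i: "i < b" "s = F j i" by auto
    have "(a * int i - (j - p * int b)) div int b = (a * int i - j) div int b + p"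
      using b0 div_mult_self1[of "int b" "a * int i - j" p] by (simp add: algebra_simps)
    then have "F (j - p * int b) i = ?E 0 (- p) 0 \<otimes> s"
      using xc by (simp add: i F_def mon_act algebra_simps)
    then show "w (j - p * int b) \<preceq> ?E 0 (- p) 0 \<otimes> s" using wF[OF i(1)] by metis
  qed auto
  have mono1: "w j \<preceq> w j'" if "j \<le> j'" for j j'
    unfolding w_def[of j'] using F
  proof (intro Meet_greatest)
    fix s assume "s \<in> F j' ` {..<b}"
    then obtain i where i: "i < b" "s = F j' i" by auto
    have "F j i \<preceq> F j' i" unfolding F_def using xg xf that b0
      by (intro mon_le_mono) (auto intro!: zdiv_mono1)
    then show "w j \<preceq> s" using wF[OF i(1)] le_trans i by blast
  qed auto
  \<comment> \<open>Raising the level by \<open>b\<close> costs one factor \<open>g\<close>, which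
    \<open>D [^] c\<close> absorbs.\<close>
  have top: "w (int b) \<preceq> D [^] c \<otimes> w 0"
    unfolding w_def[of 0] using F
  proof (rule le_mult_Meet)
    fix s assume "s \<in> F 0 ` {..<b}"
    then obtain i where i: "i < b" "s = F 0 i" by auto
    define t where "t = - ((a * int i) div int b)"
    have "(a * int i - int b) div int b = (a * int i) div int b - 1"
      using b0 div_mult_self1[of "int b" "a * int i" "-1"] by simp
    then have "F (int b) i = ?E (int i) (t + 1) 0 \<otimes> x" by (simp add: F_def t_def)
    also have "\<dots> \<preceq> ?E (int i) (t + 1) 0 \<otimes> (D [^] c \<otimes> inv g \<otimes> x)"
      using xD by (intro le_mult_left) auto
    also have "\<dots> = D [^] c \<otimes> (?E (int i) (t + 1) 0 \<otimes> (?E 0 (- 1) 0 \<otimes> x))"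
      using xc D_A mon_inv[of 0 1 0] by (simp add: mon_unit m_assoc A_lcomm[of _ "D [^] c"])
    also have "\<dots> = D [^] c \<otimes> s"
      using xc by (simp add: mon_act i F_def t_def)
    finally show "w (int b) \<preceq> D [^] c \<otimes> s" using wF[OF i(1)] le_trans by blast
  qed auto
  have wc: "w j \<in> carrier G" for j using wF[OF b0] by auto
  let ?I = "{y. w 0 \<preceq> y \<and> y \<preceq> D [^] c \<otimes> w 0}"
  have "\<not> inj_on (\<lambda>i. w (int i)) {..b}"
  proof
    assume inj: "inj_on (\<lambda>i. w (int i)) {..b}"
    have "(\<lambda>i. w (int i)) ` {..b} \<subseteq> ?I"
      using mono1 le_trans[OF mono1 top] by auto
    then have "card {..b} \<le> card ?I"
      using inj finite_interval(1)[OF wc] by (intro card_inj_on_le) auto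
    also have "\<dots> \<le> card {m \<in> Q. inv m \<otimes> D [^] c \<in> Q}" by (rule finite_interval(2)[OF wc])
    finally show False using b by simp
  qed
  then obtain i i' where i: "i < i'" "w (int i) = w (int i')"
    unfolding inj_on_def by (metis linorder_neqE_nat)
  \<comment> \<open>By the Bezout relation, \<open>q\<close> steps up by \<open>a\<close> and one
    shift down by \<open>p * int b\<close> lower the level by exactly one. This comes back from
    \<open>int i + 1\<close> to \<open>int i\<close>, between which \<open>w\<close> is
    stationary.\<close>
  have idx: "int i = ((int i + 1) + int q * a) - p * int b"
    using bezout mult.commute[of a "int q"] by linarith
  have "w (((int i + 1) + int q * a) - p * int b) \<preceq> ?E 0 (- p) 0 \<otimes> w ((int i + 1) + int q * a)"
    by (rule shift)
  also have "\<dots> \<preceq> ?E 0 (- p) 0 \<otimes> (?E (int q) 0 (int (q * k)) \<otimes> w (int i + 1))"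
    by (intro le_mult_left steps) auto
  also have "\<dots> = ?E (int q) (- p) (int (q * k)) \<otimes> w (int i + 1)"
    using wc by (simp add: mon_act)
  finally have "w (int i) \<preceq> ?E (int q) (- p) (int (q * k)) \<otimes> w (int i + 1)"
    by (simp only: idx[symmetric])
  moreover have "w (int i + 1) \<preceq> w (int i)"
    using i(1) mono1[of "int i + 1" "int i'"] unfolding i(2) by simp
  ultimately show ?thesis unfolding pos_def using le_trans mon_carrier by blast
qed

text \<open>A large denominator can be lowered without lowering the slope. For a reduced fraction
  the next fraction given by Bezout does it; otherwise the common factor is cancelled by extracting
  a root.\<close>

lemma slope_step:
  fixes b k :: nat and a :: int
  assumes pos_gf: "pos g" "pos f" and c: "pos (D [^] (c::nat) \<otimes> inv g)"
    and u: "pos (mon h g f (int b) (- a) (int k))"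
    and b: "card {m \<in> Q. inv m \<otimes> D [^] c \<in> Q} < b"
  shows "\<exists>q p k'. 0 < q \<and> q < b \<and> pos (mon h g f (int q) (- p) (int k')) \<and> a * int q \<le> p * int b"
proof (cases "gcd a (int b) = 1")
  case True
  obtain s t where st: "s * a + t * int b = 1" using bezout_int[of a "int b"] True by auto
  \<comment> \<open>The trivial divisor makes the cardinality positive, hence
    \<open>b \<ge> 2\<close>; this excludes \<open>q = 0\<close> below.\<close>
  have "\<one> \<in> {m \<in> Q. inv m \<otimes> D [^] c \<in> Q}" using Q_one D_pow_Q by simp
  then have "card {m \<in> Q. inv m \<otimes> D [^] c \<in> Q} > 0" using finite_divisors card_gt_0_iff by blast
  then have b2: "b \<ge> 2" using b by simp
  \<comment> \<open>The residue \<open>q\<close> satisfies \<open>a * int q \<equiv> -1\<close>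
    modulo \<open>b\<close>, and \<open>p\<close> is the matching cofactor.\<close>
  define q where "q = nat ((- s) mod int b)"
  define p where "p = t - a * ((- s) div int b)"
  have q: "int q = - s - int b * ((- s) div int b)"
    using b2 unfolding q_def by (simp add: minus_mult_div_eq_mod)
  have bez: "a * int q + 1 = p * int b" unfolding q p_def using st by (simp add: algebra_simps)
  have "q < b" using b2 unfolding q_def by (simp add: nat_less_iff)
  moreover have "q \<noteq> 0"
  proof
    assume "q = 0"
    then have "int b dvd 1" using bez by (metis add_0 dvd_triv_right mult_zero_right of_nat_0)
    then show False using b2 by simp
  qed
  moreover have "pos (mon h g f (int q) (- p) (int (q * k)))"
    using slope_step_coprime[OF pos_gf c u b bez] .
  moreover have "a * int q \<le> p * int b" using bez by simp
  ultimately show ?thesis by (intro exI[of _ q] exI[of _ p] exI[of _ "q * k"]) simp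
next
  case False
  define e where "e = nat (gcd a (int b))"
  have b0: "0 < b" using b by simp
  have e: "int e = gcd a (int b)" by (simp add: e_def)
  then have e1: "e > 1" using False b0 by (metis One_nat_def Suc_lessI gcd_pos_int of_nat_0_less_iff of_nat_1 of_nat_less_0_iff zero_less_iff_neq_zero of_nat_0)
  obtain a' where a': "a = int e * a'" using e by (metis gcd_dvd1 dvdE)
  obtain b' where b': "b = e * b'" using e by (metis gcd_dvd2 dvdE int_dvd_int_iff)
  \<comment> \<open>Extra factors of \<open>f\<close> raise its exponent from \<open>k\<close> to
    \<open>k * e\<close>, so that the whole monomial is an \<open>e\<close>-th power.\<close>
  have fe: "f [^] (k * (e - 1)) = mon h g f 0 0 (int k * int (e - 1))"
    using int_pow_int[of G f "k * (e - 1)"] by (simp add: mon_def)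
  have "pos (mon h g f (int b) (- a) (int k) \<otimes> f [^] (k * (e - 1)))"
    using u pos_gf by (intro pos_mult pos_pow) auto
  moreover have "mon h g f (int b) (- a) (int k) \<otimes> f [^] (k * (e - 1)) =
      mon h g f (int b') (- a') (int k) [^] e"
    unfolding fe mon_mult mon_pow using e1 by (simp add: a' b' of_nat_diff algebra_simps)
  ultimately have "pos (mon h g f (int b') (- a') (int k))"
    using e1 pos_root[of "mon h g f (int b') (- a') (int k)" e] by auto
  moreover have b'0: "0 < b'" using b' b0 by (cases b') auto
  moreover have "b' < b" using mult_strict_right_mono[OF e1 b'0] b' by simp
  moreover have "a * int b' \<le> a' * int b" by (simp add: a' b')
  ultimately show ?thesis by (intro exI[of _ b'] exI[of _ a'] exI[of _ k]) simp
qed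

text \<open>Iterating \<open>slope_step\<close> ends at a denominator bounded in terms of
  \<open>c\<close> alone, with at least the original slope. A supremum of slopes therefore involves
  only finitely many denominators and can be attained.\<close>

lemma slope_bounded_denominator:
  fixes b k :: nat and a :: int
  assumes pos_gf: "pos g" "pos f" and c: "pos (D [^] (c::nat) \<otimes> inv g)"
    and "pos (mon h g f (int b) (- a) (int k))" "0 < b"
  shows "\<exists>q p k'. 0 < q \<and> q \<le> card {m \<in> Q. inv m \<otimes> D [^] c \<in> Q} \<and>
    pos (mon h g f (int q) (- p) (int k')) \<and> a * int q \<le> p * int b"
  using assms(4,5)
proof (induction b arbitrary: a k rule: less_induct)
  case (less b)
  show ?case
  proof (cases "b \<le> card {m \<in> Q. inv m \<otimes> D [^] c \<in> Q}")
    case True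
    then show ?thesis using less.prems by (intro exI[of _ b] exI[of _ a] exI[of _ k]) simp
  next
    case False
    then obtain q p k' where q: "0 < q" "q < b" "pos (mon h g f (int q) (- p) (int k'))"
      "a * int q \<le> p * int b"
      using slope_step[OF pos_gf c less.prems(1)] by auto
    from less.IH[OF q(2,3,1)] obtain q' p' k'' where
      q': "0 < q'" "q' \<le> card {m \<in> Q. inv m \<otimes> D [^] c \<in> Q}"
        "pos (mon h g f (int q') (- p') (int k''))" "p * int q' \<le> p' * int q"
      by blast
    have "(a * int q) * int q' \<le> (p * int b) * int q'" using q(4) by (intro mult_right_mono) auto
    also have "\<dots> = (p * int q') * int b" by simp
    also have "\<dots> \<le> (p' * int q) * int b" using q'(4) by (intro mult_right_mono) auto
    finally have "int q * (a * int q') \<le> int q * (p' * int b)" by (simp add: mult_ac)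
    then have "a * int q' \<le> p' * int b" using q(1) by simp
    then show ?thesis using q' by (intro exI[of _ q'] exI[of _ p'] exI[of _ k'']) simp
  qed
qed

section \<open>Dominance read off from exponents, and intermediate elements\<close>

lemma mon_pos_mult:
  assumes "pos (mon h g f i j k)" "pos (mon h g f i' j' k')"
    and "i'' = i + i'" "j'' = j + j'" "k'' = k + k'"
  shows "pos (mon h g f i'' j'' k'')"
  using pos_mult[OF _ _ assms(1,2)] assms(3-) by (simp add: mon_mult)

lemma mon_pos_scale:
  assumes "pos (mon h g f i j k)" "i' = int n * i" "j' = int n * j" "k' = int n * k"
  shows "pos (mon h g f i' j' k')"
  using pos_pow[OF _ assms(1), of n] assms(2-) by (simp add: mon_pow)

lemma mon_pos_nonneg:
  assumes "pos g" "pos f" "0 \<le> j" "0 \<le> k"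
  shows "pos (mon h g f 0 j k)"
proof -
  have "mon h g f 0 j k = g [^] nat j \<otimes> f [^] nat k"
    using assms by (simp add: mon_def int_pow_int[symmetric])
  moreover have "pos (g [^] nat j \<otimes> f [^] nat k)"
    using assms by (intro pos_mult pos_pow) auto
  ultimately show ?thesis by (simp only:)
qed

lemma dominated_iff_mon:
  "mon h g f i j k \<unlhd> g \<longleftrightarrow> (\<exists>n::nat. pos (mon h g f (- i) (int n - j) (- k)))"
  "mon h g f i j k \<unlhd> f \<longleftrightarrow> (\<exists>n::nat. pos (mon h g f (- i) (- j) (int n - k)))"
  "g \<unlhd> mon h g f i j k \<longleftrightarrow>
    (\<exists>n::nat. pos (mon h g f (int n * i) (int n * j - 1) (int n * k)))"
  "f \<unlhd> mon h g f i j k \<longleftrightarrow>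
    (\<exists>n::nat. pos (mon h g f (int n * i) (int n * j) (int n * k - 1)))"
proof -
  have g: "g [^] n = mon h g f 0 (int n) 0" and f: "f [^] n = mon h g f 0 0 (int n)" for n :: nat
    by (simp_all add: mon_def int_pow_int)
  have gi: "inv g = mon h g f 0 (- 1) 0" and fi: "inv f = mon h g f 0 0 (- 1)"
    using mon_inv[of 0 1 0] mon_inv[of 0 0 1] by (simp_all add: mon_unit)
  show "mon h g f i j k \<unlhd> g \<longleftrightarrow> (\<exists>n::nat. pos (mon h g f (- i) (int n - j) (- k)))"
    "mon h g f i j k \<unlhd> f \<longleftrightarrow> (\<exists>n::nat. pos (mon h g f (- i) (- j) (int n - k)))"
    "g \<unlhd> mon h g f i j k \<longleftrightarrow>
      (\<exists>n::nat. pos (mon h g f (int n * i) (int n * j - 1) (int n * k)))"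
    "f \<unlhd> mon h g f i j k \<longleftrightarrow>
      (\<exists>n::nat. pos (mon h g f (int n * i) (int n * j) (int n * k - 1)))"
    unfolding dominated_def by (simp_all add: g f gi fi mon_inv mon_mult mon_pow)
qed

lemma dominated_trans:
  assumes "h \<unlhd> g" "g \<unlhd> f"
  shows "h \<unlhd> f"
proof -
  obtain k :: nat where k: "pos (mon h g f (- 1) (int k) 0)"
    using assms(1) dominated_iff_mon(1)[of 1 0 0] by (auto simp: mon_unit)
  obtain l :: nat where "pos (mon h g f 0 (- 1) (int l))"
    using assms(2) dominated_iff_mon(2)[of 0 1 0] by (auto simp: mon_unit)
  then have "pos (mon h g f 0 (- int k) (int (k * l)))"
    by (rule mon_pos_scale[of _ _ _ _ k]) auto
  with k have "pos (mon h g f (- 1) 0 (int (k * l)))" by (rule mon_pos_mult) auto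
  then have "mon h g f 1 0 0 \<unlhd> f"
    unfolding dominated_iff_mon(2) by (intro exI[of _ "k * l"]) simp
  then show ?thesis by (simp add: mon_unit)
qed

text \<open>At a maximal slope \<open>p/q\<close> with third exponent \<open>k\<close>, the monomial
  \<open>v\<close> with exponents \<open>q\<close>, \<open>-p\<close>, \<open>k + 1\<close> lies
  strictly between. If \<open>f\<close> dominated \<open>v\<close>, the monomial without
  \<open>f\<close> would lie in the face of \<open>f\<close>, against \<open>indep\<close>; if
  \<open>v\<close> dominated \<open>g\<close>, a larger slope would occur.\<close>

lemma sdominated_between:
  assumes pos_gf: "pos g" "pos f" and fg: "f \<lhd>\<lhd> g" and hg: "h \<unlhd> g" "inv h \<unlhd> g"
    and indep: "\<And>q p. 0 < q \<Longrightarrow>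
      \<not> (mon h g f (int q) p 0 \<unlhd> f \<and> inv (mon h g f (int q) p 0) \<unlhd> f)"
  shows "\<exists>v\<in>A. pos v \<and> f \<lhd>\<lhd> v \<and> v \<lhd>\<lhd> g"
proof -
  let ?E = "mon h g f"
  obtain c :: nat where c: "pos (D [^] c \<otimes> inv g)" using pos_D_pow[of "inv g"] by auto
  define n where "n = card {m \<in> Q. inv m \<otimes> D [^] c \<in> Q}"
  obtain k1 :: nat where k1: "pos (?E (- 1) (int k1) 0)"
    using hg(1) dominated_iff_mon(1)[of 1 0 0] by (auto simp: mon_unit)
  obtain k2 :: nat where k2: "pos (?E 1 (int k2) 0)"
    using hg(2) dominated_iff_mon(1)[of "- 1" 0 0] mon_inv[of 1 0 0] by (auto simp: mon_unit)
  obtain k3 :: nat where k3: "pos (?E 0 (int k3) (- 1))"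
    using fg dominated_iff_mon(1)[of 0 0 1] by (auto simp: mon_unit sdominated_def)
  have not_gf: "\<not> pos (?E 0 (- 1) (int k))" for k :: nat
    using fg dominated_iff_mon(2)[of 0 1 0] by (auto simp: mon_unit sdominated_def)
  \<comment> \<open>With a larger slope, cancelling \<open>h\<close> by means of \<open>k1\<close>
    would leave \<open>inv g\<close> times a power of \<open>f\<close> positive, so \<open>f\<close>
    would dominate \<open>g\<close>.\<close>
  have bounded: "p \<le> int k1 * int q" if "pos (?E (int q) (- p) (int k))" for q p k
  proof (rule ccontr)
    assume less: "\<not> p \<le> int k1 * int q"
    have "pos (?E (- int q) (int k1 * int q) 0)"
      using k1 by (rule mon_pos_scale[of _ _ _ _ q]) auto
    with that have "pos (?E 0 (int k1 * int q - p) (int k))" by (rule mon_pos_mult) auto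
    moreover have "pos (?E 0 (p - int k1 * int q - 1) 0)"
      using pos_gf less by (intro mon_pos_nonneg) auto
    ultimately have "pos (?E 0 (- 1) (int k))" by (rule mon_pos_mult) auto
    then show False using not_gf by blast
  qed
  define T where "T = (\<lambda>(q, p, k). 0 < q \<and> q \<le> n \<and> pos (?E (int q) (- p) (int k)))"
  have slope: "\<exists>q p k'. T (q, p, k') \<and> a * int q \<le> p * int b"
    if "pos (?E (int b) (- a) (int k))" "0 < b" for a b k
    using slope_bounded_denominator[OF pos_gf c that] by (auto simp: T_def n_def)
  define L where "L = int (fact n)"
  have "L > 0" by (simp add: L_def)
  have L: "L = int q * (L div int q)" if "0 < q" "q \<le> n" for q
  proof -
    have "int q dvd L" unfolding L_def int_dvd_int_iff using that by (intro dvd_fact) auto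
    then show ?thesis by simp
  qed
  \<comment> \<open>Over the common denominator \<open>L\<close> the slope \<open>p/q\<close> has
    numerator \<open>p * (L div int q)\<close>, so minimizing \<open>m\<close> maximizes the slope.
    The \<open>+ 1\<close> keeps the least value positive, so truncation by \<open>nat\<close> does
    no harm.\<close>
  define m where "m = (\<lambda>(q, p, k::nat). nat (int k1 * L + 1 - p * (L div int q)))"
  have "\<exists>t. T t" using slope[of 1 "- int k2" 0] k2 by auto
  then obtain q p k where T: "T (q, p, k)" and least: "\<And>t. T t \<Longrightarrow> m (q, p, k) \<le> m t"
    using ex_has_least_nat[of T _ m] by (metis prod_cases3)
  have q: "0 < q" "q \<le> n" and E: "pos (?E (int q) (- p) (int k))" using T by (auto simp: T_def)
  have maximal: "p' * int q \<le> p * int q'" if T': "T (q', p', k')" for q' p' k'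
  proof -
    have q': "0 < q'" "q' \<le> n" using T' by (auto simp: T_def)
    have "p * (L div int q) \<le> (int k1 * int q) * (L div int q)"
      using bounded[OF E] \<open>L > 0\<close> q by (intro mult_right_mono) (auto simp: pos_imp_zdiv_nonneg_iff)
    also have "\<dots> = int k1 * L" using L[OF q] by simp
    finally have "p' * (L div int q') \<le> p * (L div int q)"
      using least[OF T'] by (simp add: m_def)
    then have "(int q * int q') * (p' * (L div int q')) \<le> (int q * int q') * (p * (L div int q))"
      by (intro mult_left_mono) auto
    also have "(int q * int q') * (p' * (L div int q')) = (p' * int q) * L"
      by (subst (2) L[OF q']) simp
    also have "(int q * int q') * (p * (L div int q)) = (p * int q') * L"
      by (subst (2) L[OF q]) simp
    finally show ?thesis using \<open>L > 0\<close> by simp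
  qed
  \<comment> \<open>One more factor \<open>f\<close> than \<open>E\<close> provides: removing it
    leaves a positive element, so \<open>v\<close> dominates \<open>f\<close> already with exponent
    one.\<close>
  define v where "v = ?E (int q) (- p) (int k + 1)"
  have vA: "v \<in> A" by (simp add: v_def)
  have "pos (?E 0 0 1)" using pos_gf by (intro mon_pos_nonneg) auto
  with E have v: "pos v" unfolding v_def by (rule mon_pos_mult) auto
  have "f \<unlhd> v" unfolding v_def dominated_iff_mon(4)
    using E by (intro exI[of _ 1]) simp
  moreover have "\<not> v \<unlhd> f"
  proof
    assume "v \<unlhd> f"
    then obtain l :: nat where "pos (?E (- int q) p (int l - (int k + 1)))"
      by (auto simp: v_def dominated_iff_mon(2))
    moreover have "pos (?E 0 0 (int k + 1))" using pos_gf by (intro mon_pos_nonneg) auto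
    ultimately have "pos (?E (- int q) p (int l))" by (rule mon_pos_mult) auto
    then have "?E (int q) (- p) 0 \<unlhd> f" unfolding dominated_iff_mon(2) by auto
    moreover have "inv (?E (int q) (- p) 0) \<unlhd> f"
      unfolding mon_inv dominated_iff_mon(2) using E by auto
    ultimately show False using indep[OF q(1)] by blast
  qed
  moreover have "v \<unlhd> g"
  proof -
    have "pos (?E (- int q) (int q * int k1) 0)"
      using k1 by (rule mon_pos_scale[of _ _ _ _ q]) auto
    moreover have "pos (?E 0 (int (k + 1) * int k3) (- int (k + 1)))"
      using k3 by (rule mon_pos_scale[of _ _ _ _ "k + 1"]) auto
    ultimately have "pos (?E (- int q) (int q * int k1 + int (k + 1) * int k3) (- int (k + 1)))"
      by (rule mon_pos_mult) auto
    moreover have "pos (?E 0 (int (nat \<bar>p\<bar>) + p) 0)"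
      using pos_gf by (intro mon_pos_nonneg) auto
    ultimately have "pos (?E (- int q) (int (q * k1 + (k + 1) * k3 + nat \<bar>p\<bar>) + p) (- int (k + 1)))"
      by (rule mon_pos_mult) (auto simp: algebra_simps)
    then show ?thesis unfolding v_def dominated_iff_mon(1)
      by (intro exI[of _ "q * k1 + (k + 1) * k3 + nat \<bar>p\<bar>"]) (simp add: algebra_simps)
  qed
  moreover have "\<not> g \<unlhd> v"
  proof
    assume "g \<unlhd> v"
    then obtain j :: nat where "pos (?E (int j * int q) (int j * (- p) - 1) (int j * (int k + 1)))"
      by (auto simp: v_def dominated_iff_mon(3))
    \<comment> \<open>The additional factor \<open>v\<close> keeps the denominator positive even for
      \<open>j = 0\<close>. The new slope exceeds \<open>p/q\<close> by one over that
      denominator.\<close>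
    with v have "pos (?E (int (Suc j * q)) (- (int (Suc j) * p + 1)) (int (Suc j * (k + 1))))"
      unfolding v_def by (rule mon_pos_mult) (auto simp: algebra_simps)
    from slope[OF this] q obtain q' p' k' where T': "T (q', p', k')"
      and le: "(int (Suc j) * p + 1) * int q' \<le> p' * int (Suc j * q)"
      by auto
    have "p' * int (Suc j * q) = int (Suc j) * (p' * int q)" by (simp add: algebra_simps)
    also have "\<dots> \<le> int (Suc j) * (p * int q')"
      using maximal[OF T'] by (intro mult_left_mono) auto
    finally have "int q' \<le> 0" using le by (simp add: algebra_simps)
    then show False using T' by (simp add: T_def)
  qed
  ultimately show ?thesis using v vA by (auto simp: sdominated_def)
qed

end

subsection \<open>Faces and finite orbits\<close>

definition normalizing :: "'a set" where
  "normalizing = {z \<in> carrier G. \<forall>a\<in>A. z \<otimes> a \<otimes> inv z \<in> A}"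

text \<open>The conjugate of \<open>h\<close> by \<open>z\<close> is again in \<open>A\<close> and
  has the same \<open>q\<close>-th power as \<open>h\<close>; roots in \<open>A\<close> are
  unique.\<close>

lemma commute_root:
  assumes z: "z \<in> normalizing" and h: "h \<in> A" and "0 < (q::nat)"
    and zq: "z \<otimes> h [^] q = h [^] q \<otimes> z"
  shows "z \<otimes> h = h \<otimes> z"
proof -
  have zc: "z \<in> carrier G" and conj: "z \<otimes> h \<otimes> inv z \<in> A" using z h by (auto simp: normalizing_def)
  have "(z \<otimes> h \<otimes> inv z) [^] q = h [^] q \<otimes> z \<otimes> inv z"
    using conj_nat_pow[OF zc A_carrier[OF h], of q] zq by simp
  also have "\<dots> = h [^] q" using zc h by (simp add: m_assoc)
  finally have "z \<otimes> h \<otimes> inv z = h" using root_unique conj h assms(3) by blast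
  then have "z \<otimes> h \<otimes> inv z \<otimes> z = h \<otimes> z" by simp
  then show ?thesis using zc h by (simp add: m_assoc)
qed

definition face :: "'a \<Rightarrow> 'a set" where
  "face f = {h \<in> A. h \<unlhd> f \<and> inv h \<unlhd> f}"

text \<open>This stands in for finite rank: a finite set plays the part of a basis, as far as
  commuting with normalizing elements is concerned.\<close>

definition finitely_detected :: "'a set \<Rightarrow> bool" where
  "finitely_detected B \<longleftrightarrow> (\<exists>S. finite S \<and> S \<subseteq> A \<and>
    (\<forall>z\<in>normalizing. (\<forall>s\<in>S. z \<otimes> s = s \<otimes> z) \<longrightarrow> (\<forall>h\<in>B. z \<otimes> h = h \<otimes> z)))"

lemma face_one: "face \<one> = {\<one>}"
proof
  show "face \<one> \<subseteq> {\<one>}"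
  proof
    fix h assume "h \<in> face \<one>"
    then have "h \<in> A" "pos h" "pos (inv h)" by (auto simp: face_def dominated_def)
    then show "h \<in> {\<one>}" using pos_antisym by blast
  qed
qed (auto simp: face_def dominated_def)

lemma dominated_D: "f \<in> A \<Longrightarrow> f \<unlhd> D"
  using pos_D_pow[of "inv f"] by (auto simp: dominated_def)

definition pos_chain_rel :: "('a \<times> 'a) set" where
  "pos_chain_rel = {(f, g). f \<in> A \<and> g \<in> A \<and> pos f \<and> pos g \<and> f \<lhd>\<lhd> g}"

text \<open>The uniform chain bound forbids infinite chains in both directions. One direction yields
  least elements above a given one, the other yields maximal elements.\<close>

lemma wf_pos_chain_rel: "wf pos_chain_rel" "wf (pos_chain_rel\<inverse>)"
proof -
  let ?N = "card {m \<in> Q. inv m \<otimes> D [^] (1::nat) \<in> Q}"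
  show "wf pos_chain_rel"
    unfolding wf_iff_no_infinite_down_chain
  proof
    assume "\<exists>s. \<forall>i. (s (Suc i), s i) \<in> pos_chain_rel"
    then obtain s where s: "\<And>i. (s (Suc i), s i) \<in> pos_chain_rel" by blast
    have "Suc ?N \<le> ?N"
    \<comment> \<open>Read backwards from index \<open>Suc ?N\<close>, the descending sequence is an
      ascending chain one step too long.\<close>
    proof (rule sdominated_chain_bound[of _ "\<lambda>i. s (Suc ?N - i)"])
      fix i assume "i < Suc ?N"
      then have "Suc ?N - i = Suc (Suc ?N - Suc i)" by simp
      then show "s (Suc ?N - i) \<lhd>\<lhd> s (Suc ?N - Suc i)"
        using s[of "Suc ?N - Suc i"] by (simp only: pos_chain_rel_def) auto
    qed (use s in \<open>auto simp: pos_chain_rel_def\<close>)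
    then show False by simp
  qed
  show "wf (pos_chain_rel\<inverse>)"
    unfolding wf_iff_no_infinite_down_chain
  proof
    assume "\<exists>s. \<forall>i. (s (Suc i), s i) \<in> pos_chain_rel\<inverse>"
    then obtain s where s: "\<And>i. (s i, s (Suc i)) \<in> pos_chain_rel" by blast
    have "Suc ?N \<le> ?N"
      by (rule sdominated_chain_bound[of _ s]) (use s in \<open>auto simp: pos_chain_rel_def\<close>)
    then show False by simp
  qed
qed

text \<open>Adding \<open>g\<close> to the detecting set suffices. With nothing strictly between,
  \<open>sdominated_between\<close> puts some \<open>h [^] q\<close> times a power of
  \<open>g\<close> into the face of \<open>f\<close>. An element commuting with that product and
  with \<open>g\<close> commutes with \<open>h [^] q\<close>, hence with \<open>h\<close>.\<close>

lemma finitely_detected_cover: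
  assumes f: "f \<in> A" "pos f" and g: "g \<in> A" "pos g" and fg: "f \<lhd>\<lhd> g"
    and cover: "\<not> (\<exists>v\<in>A. pos v \<and> f \<lhd>\<lhd> v \<and> v \<lhd>\<lhd> g)"
    and det: "finitely_detected (face f)"
  shows "finitely_detected (face g)"
proof -
  obtain S where S: "finite S" "S \<subseteq> A"
    "\<And>z h. \<lbrakk>z \<in> normalizing; \<forall>s\<in>S. z \<otimes> s = s \<otimes> z; h \<in> face f\<rbrakk> \<Longrightarrow> z \<otimes> h = h \<otimes> z"
    using det unfolding finitely_detected_def by blast
  have "z \<otimes> h = h \<otimes> z"
    if z: "z \<in> normalizing" "\<forall>s\<in>insert g S. z \<otimes> s = s \<otimes> z" and h: "h \<in> face g" for z h
  proof -
    have hA: "h \<in> A" "h \<unlhd> g" "inv h \<unlhd> g" using h by (auto simp: face_def)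
    obtain q p where q: "0 < q" and e: "mon h g f (int q) p 0 \<unlhd> f"
      "inv (mon h g f (int q) p 0) \<unlhd> f"
      using sdominated_between[OF hA(1) g(1) f(1) g(2) f(2) fg hA(2,3)] cover by blast
    define e' where "e' = mon h g f (int q) p 0"
    have e'A: "e' \<in> A" using hA f g by (simp add: e'_def mon_A)
    have "e' \<in> face f" using e e'A by (simp add: face_def e'_def)
    then have ze: "z \<otimes> e' = e' \<otimes> z" using S z by blast
    have zc: "z \<in> carrier G" using z by (simp add: normalizing_def)
    note C = commutant_subgroup[OF zc]
    have gC: "g \<in> {a \<in> carrier G. z \<otimes> a = a \<otimes> z}" using z g by auto
    have "g [^] (- p) \<in> {a \<in> carrier G. z \<otimes> a = a \<otimes> z}"
      by (rule subgroup_int_pow_closed[OF C gC])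
    moreover have "e' \<in> {a \<in> carrier G. z \<otimes> a = a \<otimes> z}" using ze e'A by auto
    ultimately have "e' \<otimes> g [^] (- p) \<in> {a \<in> carrier G. z \<otimes> a = a \<otimes> z}"
      using subgroup.m_closed[OF C] by blast
    also have "g [^] (- p) = mon h g f 0 (- p) 0" using g by (simp add: mon_def)
    also have "e' \<otimes> mon h g f 0 (- p) 0 = mon h g f (int q) 0 0"
      using hA f g by (simp add: e'_def mon_mult)
    also have "\<dots> = h [^] q" using hA by (simp add: mon_def int_pow_int)
    finally show ?thesis using commute_root[OF z(1) hA(1) q] by auto
  qed
  then show ?thesis unfolding finitely_detected_def
    using S g by (intro exI[of _ "insert g S"]) auto
qed

text \<open>Starting from the trivial face of \<open>\<one>\<close>, a maximal \<open>f\<close> with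
  detected face is taken. It must dominate \<open>D\<close>, since otherwise a cover of
  \<open>f\<close> would also have a detected face; and the face of an element dominating
  \<open>D\<close> is all of \<open>A\<close>.\<close>

lemma finitely_detected_A: "finitely_detected A"
proof -
  define P where "P = {f \<in> A. pos f \<and> finitely_detected (face f)}"
  have "\<one> \<in> P" unfolding P_def finitely_detected_def
    by (auto simp: face_one normalizing_def intro!: exI[of _ "{}"])
  then obtain f where f: "f \<in> P" and fmax: "\<And>g. (g, f) \<in> pos_chain_rel\<inverse> \<Longrightarrow> g \<notin> P"
    using wfE_min[OF wf_pos_chain_rel(2)] by metis
  have fA: "f \<in> A" "pos f" "finitely_detected (face f)" using f by (auto simp: P_def)
  have posD: "pos D" 
    using le_D_pow_mult[OF one_closed, of 1] unfolding pos_def by (intro conjI exI[of _ \<one>]) auto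
  have "D \<unlhd> f"
  proof (rule ccontr)
    assume "\<not> D \<unlhd> f"
    then have D: "D \<in> {g. (f, g) \<in> pos_chain_rel}"
      using fA posD D_A dominated_D by (auto simp: pos_chain_rel_def sdominated_def)
    \<comment> \<open>A minimal element strictly above \<open>f\<close> exists because
      \<open>D\<close> is one of the candidates; minimality leaves no room between \<open>f\<close>
      and \<open>g\<close>.\<close>
    obtain g where g: "(f, g) \<in> pos_chain_rel"
      and gmin: "\<And>v. (v, g) \<in> pos_chain_rel \<Longrightarrow> (f, v) \<notin> pos_chain_rel"
      using wfE_min[OF wf_pos_chain_rel(1) D] by (metis mem_Collect_eq)
    have "finitely_detected (face g)"
      using g gmin fA by (intro finitely_detected_cover[of f g]) (auto simp: pos_chain_rel_def)
    then have "g \<in> P" using g by (auto simp: P_def pos_chain_rel_def)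
    then show False using fmax[of g] g by auto
  qed
  then have "face f = A"
    using dominated_trans[OF _ D_A fA(1)] dominated_D by (auto simp: face_def)
  then show ?thesis using fA(3) by simp
qed

section \<open>Finiteness of orbits under conjugation\<close>

text \<open>For finite \<open>T\<close>, a common base point \<open>x\<close> makes
  \<open>t \<mapsto> D [^] r \<otimes> t \<otimes> x\<close> an injection into the interval from
  \<open>x\<close> to \<open>D [^] (r + r) \<otimes> x\<close>. The point depends on
  \<open>T\<close> but the size of the interval is bounded uniformly, which bounds \<open>C\<close>
  itself.\<close>

lemma finite_bounded_subset:
  assumes C: "C \<subseteq> A"
    and r: "\<And>t. t \<in> C \<Longrightarrow> pos (D [^] (r::nat) \<otimes> t)" "\<And>t. t \<in> C \<Longrightarrow> pos (D [^] r \<otimes> inv t)"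
  shows "finite C"
proof -
  let ?K = "card {m \<in> Q. inv m \<otimes> D [^] (r + r) \<in> Q}"
  have "card T \<le> ?K" if T: "T \<subseteq> C" "finite T" for T
  proof -
    have "\<exists>x\<in>carrier G. \<forall>s\<in>(\<lambda>t. D [^] r \<otimes> t) ` T \<union> (\<lambda>t. D [^] r \<otimes> inv t) ` T. x \<preceq> s \<otimes> x"
      using T C r D_A by (intro common_fixed_point) auto
    then obtain x where xc: "x \<in> carrier G" and x: "\<And>t. t \<in> T \<Longrightarrow> x \<preceq> D [^] r \<otimes> t \<otimes> x"
      "\<And>t. t \<in> T \<Longrightarrow> x \<preceq> D [^] r \<otimes> inv t \<otimes> x"
      by auto
    let ?I = "{w. x \<preceq> w \<and> w \<preceq> D [^] (r + r) \<otimes> x}"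
    have "D [^] r \<otimes> t \<otimes> x \<preceq> D [^] (r + r) \<otimes> x" if t: "t \<in> T" for t
    proof -
      have tA: "t \<in> A" using t T C by auto
      have "D [^] r \<otimes> t \<otimes> x \<preceq> D [^] r \<otimes> t \<otimes> (D [^] r \<otimes> inv t \<otimes> x)"
        using x(2)[OF t] tA by (intro le_mult_left) auto
      also have "\<dots> = D [^] r \<otimes> (D [^] r \<otimes> x)"
        using tA D_A xc by (simp add: m_assoc A_lcomm[of t "D [^] r"])
      also have "\<dots> = D [^] (r + r) \<otimes> x"
        using xc by (simp add: m_assoc[symmetric] nat_pow_mult)
      finally show ?thesis .
    qed
    then have "(\<lambda>t. D [^] r \<otimes> t \<otimes> x) ` T \<subseteq> ?I" using x by auto
    moreover have "inj_on (\<lambda>t. D [^] r \<otimes> t \<otimes> x) T"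
      using xc T C by (intro inj_onI) (auto simp: subset_eq)
    ultimately have "card T \<le> card ?I"
      using finite_interval(1)[OF xc] by (intro card_inj_on_le) auto
    also have "\<dots> \<le> ?K" by (rule finite_interval(2)[OF xc])
    finally show ?thesis .
  qed
  then show ?thesis using finite_if_finite_subsets_card_bdd[of C ?K] by blast
qed

text \<open>Positivity is invariant under conjugation and \<open>D\<close> is central, so bounds by
  powers of \<open>D\<close> for \<open>h\<close> and \<open>inv h\<close> hold for every
  conjugate.\<close>

lemma finite_orbit:
  assumes h: "h \<in> A"
  shows "finite {z \<otimes> h \<otimes> inv z | z. z \<in> normalizing}"
proof -
  obtain k :: nat where k: "pos (D [^] k \<otimes> h)" using pos_D_pow[of h] h by auto
  obtain l :: nat where l: "pos (D [^] l \<otimes> inv h)" using pos_D_pow[of "inv h"] h by auto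
  have conj: "pos (D [^] (k + l) \<otimes> (z \<otimes> a \<otimes> inv z))"
    if "pos (D [^] m \<otimes> a)" "a \<in> A" "m \<le> k + l" "z \<in> carrier G" for z a and m :: nat
  proof -
    have "pos (z \<otimes> (D [^] (k + l) \<otimes> a) \<otimes> inv z)"
      using pos_D_pow_mono[OF that(1)] that by (intro pos_conj) auto
    also have "z \<otimes> (D [^] (k + l) \<otimes> a) \<otimes> inv z = (z \<otimes> D [^] (k + l)) \<otimes> (a \<otimes> inv z)"
      using that by (simp add: m_assoc)
    also have "\<dots> = D [^] (k + l) \<otimes> (z \<otimes> a \<otimes> inv z)"
      using that unfolding D_pow_central[OF that(4)] by (simp add: m_assoc)
    finally show ?thesis .
  qed
  have "inv (z \<otimes> h \<otimes> inv z) = z \<otimes> inv h \<otimes> inv z" if "z \<in> carrier G" for z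
    using that h by (simp add: inv_mult_group m_assoc)
  then show ?thesis
    using h conj[OF k] conj[OF l]
    by (intro finite_bounded_subset[where r = "k + l"]) (auto simp: normalizing_def)
qed

end

subsection \<open>Garside monoids\<close>

context monoid begin

lemma list_prod_Nil [simp]: "list_prod G [] = \<one>"
  and list_prod_Cons [simp]: "list_prod G (x # xs) = x \<otimes> list_prod G xs"
  by (simp_all add: list_prod_def)

lemma list_prod_closed [simp]: "set xs \<subseteq> carrier G \<Longrightarrow> list_prod G xs \<in> carrier G"
  by (induction xs) auto

lemma list_prod_append:
  "\<lbrakk>set xs \<subseteq> carrier G; set ys \<subseteq> carrier G\<rbrakk> \<Longrightarrow>
    list_prod G (xs @ ys) = list_prod G xs \<otimes> list_prod G ys"
  by (induction xs) (auto simp: m_assoc)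

lemma generates_induct [consumes 2, case_names one mult]:
  assumes "generates G S" "a \<in> carrier G"
    and "P \<one>" "\<And>x y. \<lbrakk>x \<in> S; y \<in> carrier G; P y\<rbrakk> \<Longrightarrow> P (x \<otimes> y)"
  shows "P a"
proof -
  have S: "S \<subseteq> carrier G" using assms(1) by (simp add: generates_def)
  have "P (list_prod G xs)" if "set xs \<subseteq> S" for xs
    using that S by (induction xs) (auto intro: assms(3,4))
  moreover obtain xs where "set xs \<subseteq> S" "list_prod G xs = a"
    using assms(1,2) by (auto simp: generates_def)
  ultimately show ?thesis by blast
qed

text \<open>In a product over \<open>S\<close> equal to an atom, either the head or the rest is one;
  peeling off heads shows that the atom occurs in the list.\<close>

lemma atoms_subset_generators:
  assumes "generates G S"
  shows "atoms G \<subseteq> S"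
proof
  fix a assume a: "a \<in> atoms G"
  have S: "S \<subseteq> carrier G" using assms by (simp add: generates_def)
  have "a \<in> set xs" if "set xs \<subseteq> S" "list_prod G xs = a" for xs
    using that
  proof (induction xs)
    case Nil
    then show ?case using a by (auto simp: atoms_def)
  next
    case (Cons x xs)
    then have c: "x \<in> carrier G" "list_prod G xs \<in> carrier G" "a = x \<otimes> list_prod G xs"
      using S by auto
    then have "x = \<one> \<or> list_prod G xs = \<one>" using a unfolding atoms_def by blast
    then show ?case using Cons c by auto
  qed
  moreover have "\<exists>xs. set xs \<subseteq> S \<and> list_prod G xs = a"
    using assms a by (auto simp: generates_def atoms_def)
  ultimately show "a \<in> S" by blast
qed

end

context garside_monoid begin

lemma finite_atoms: "finite (atoms M)"
proof -
  obtain S where "finite S" "generates M S" using finitely_generated by blast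
  then show ?thesis using atoms_subset_generators finite_subset by blast
qed

text \<open>An atom word for a divisor extends by one for its complement to an atom word for
  \<open>d\<close>, so its length is at most \<open>max_length M d\<close>. Over finitely many atoms
  there are finitely many such words.\<close>

lemma finite_left_divisors:
  assumes d: "d \<in> carrier M"
  shows "finite {a \<in> carrier M. left_le M a d}"
proof -
  obtain n where n: "max_length M d = enat n"
    using max_length_finite[OF d] by (metis enat_ord_simps(6) infinity_ne_i0 less_infinityE)
  have atoms: "atoms M \<subseteq> carrier M" by (auto simp: atoms_def)
  have "{a \<in> carrier M. left_le M a d} \<subseteq> list_prod M ` {xs. set xs \<subseteq> atoms M \<and> length xs \<le> n}"
  proof clarify
    fix a assume a: "a \<in> carrier M" "left_le M a d"
    then obtain c where c: "c \<in> carrier M" "a \<otimes> c = d" by (auto simp: left_le_def)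
    obtain xs where xs: "set xs \<subseteq> atoms M" "list_prod M xs = a"
      using atoms_generate a by (auto simp: generates_def)
    obtain ys where ys: "set ys \<subseteq> atoms M" "list_prod M ys = c"
      using atoms_generate c by (auto simp: generates_def)
    have "list_prod M (xs @ ys) = d" using xs ys c atoms by (subst list_prod_append) auto
    then have "enat (length (xs @ ys)) \<le> max_length M d"
      unfolding max_length_def using xs ys by (intro SUP_upper) auto
    then have "length xs \<le> n" using n by simp
    then show "a \<in> list_prod M ` {xs. set xs \<subseteq> atoms M \<and> length xs \<le> n}" using xs by auto
  qed
  then show ?thesis using finite_lists_length_le[OF finite_atoms] finite_subset by blast
qed

lemma left_le_trans:
  assumes "left_le M a b" "left_le M b c" "a \<in> carrier M"
  shows "left_le M a c"
proof -
  obtain u v where "u \<in> carrier M" "a \<otimes> u = b" "v \<in> carrier M" "b \<otimes> v = c"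
    using assms by (auto simp: left_le_def)
  then show ?thesis using assms(3) by (auto simp: left_le_def m_assoc intro!: bexI[of _ "u \<otimes> v"])
qed

lemma left_le_antisym:
  "\<lbrakk>left_le M a b; left_le M b a; a \<in> carrier M; b \<in> carrier M\<rbrakk> \<Longrightarrow> a = b"
proof -
  interpret L: lattice "\<lparr>carrier = carrier M, eq = (=), le = left_le M\<rparr>" by (rule left_lattice)
  show "\<lbrakk>left_le M a b; left_le M b a; a \<in> carrier M; b \<in> carrier M\<rbrakk> \<Longrightarrow> a = b"
    using L.le_antisym[of a b] by simp
qed

lemma left_meet:
  assumes "a \<in> carrier M" "b \<in> carrier M"
  obtains m where "m \<in> carrier M" "left_le M m a" "left_le M m b"
    "\<And>w. \<lbrakk>w \<in> carrier M; left_le M w a; left_le M w b\<rbrakk> \<Longrightarrow> left_le M w m"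
proof -
  interpret L: lattice "\<lparr>carrier = carrier M, eq = (=), le = left_le M\<rparr>" by (rule left_lattice)
  obtain m where "greatest \<lparr>carrier = carrier M, eq = (=), le = left_le M\<rparr> m
      (Lower \<lparr>carrier = carrier M, eq = (=), le = left_le M\<rparr> {a, b})"
    using L.inf_of_two_exists[of a b] assms by auto
  then show ?thesis using assms by (intro that[of m]) (auto simp: greatest_def Lower_def)
qed

lemma unit_free:
  assumes "a \<in> carrier M" "b \<in> carrier M" "a \<otimes> b = \<one>"
  shows "a = \<one>"
  using assms by (intro left_le_antisym) (auto simp: left_le_def)

text \<open>Taking complements in \<open>d\<close> twice: \<open>a c = d\<close> and
  \<open>c b = d\<close> give \<open>a d = a c b = d b\<close>. The complements divide
  \<open>d\<close> on both sides because left and right divisors of \<open>d\<close>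
  coincide.\<close>

lemma garside_shift:
  assumes d: "garside_element M d" and a: "a \<in> carrier M" "left_le M a d"
  shows "\<exists>b\<in>carrier M. left_le M b d \<and> a \<otimes> d = d \<otimes> b"
proof -
  have iff: "left_le M x d \<longleftrightarrow> right_le M x d" if "x \<in> carrier M" for x
    using d that by (simp add: garside_element_def)
  obtain c where c: "c \<in> carrier M" "a \<otimes> c = d" using a by (auto simp: left_le_def)
  then have "left_le M c d" using a iff[of c] by (auto simp: right_le_def)
  then obtain b where b: "b \<in> carrier M" "c \<otimes> b = d" by (auto simp: left_le_def)
  then have "left_le M b d" using c iff[of b] by (auto simp: right_le_def)
  moreover have "a \<otimes> d = d \<otimes> b" using a b c by (metis m_assoc)
  ultimately show ?thesis using b by blast
qed

text \<open>Moving \<open>d\<close> past its divisors defines a self-map \<open>t\<close> of a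
  finite set. Two of its iterates coincide, and the difference of their exponents gives a power of
  \<open>d\<close> commuting with all generators.\<close>

lemma central_garside_power:
  assumes d: "garside_element M d"
  shows "\<exists>e>0. \<forall>x\<in>carrier M. x \<otimes> d [^] (e::nat) = d [^] e \<otimes> x"
proof -
  have dc: "d \<in> carrier M" using d by (simp add: garside_element_def)
  define S where "S = {a \<in> carrier M. left_le M a d}"
  have fin: "finite S" using finite_left_divisors[OF dc] by (simp add: S_def)
  have "\<forall>a\<in>S. \<exists>b. b \<in> S \<and> a \<otimes> d = d \<otimes> b"
    using garside_shift[OF d] by (auto simp: S_def)
  then obtain t where t: "\<And>a. a \<in> S \<Longrightarrow> t a \<in> S" "\<And>a. a \<in> S \<Longrightarrow> a \<otimes> d = d \<otimes> t a"
    unfolding bchoice_iff by auto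
  have tS: "(t ^^ n) a \<in> S" if "a \<in> S" for a n
    using that t(1) by (induction n) auto
  have shift: "a \<otimes> d [^] n = d [^] n \<otimes> (t ^^ n) a" if a: "a \<in> S" for a and n :: nat
  proof (induction n)
    case (Suc n)
    have c: "a \<in> carrier M" "(t ^^ n) a \<in> carrier M" "t ((t ^^ n) a) \<in> carrier M"
      using a tS[OF a] t(1) by (auto simp: S_def)
    have "a \<otimes> d [^] Suc n = d [^] n \<otimes> (t ^^ n) a \<otimes> d"
      using Suc c dc by (simp add: m_assoc[symmetric])
    also have "\<dots> = d [^] n \<otimes> (d \<otimes> t ((t ^^ n) a))"
      using c dc t(2)[OF tS[OF a]] by (simp add: m_assoc)
    finally show ?case using c dc by (simp add: m_assoc)
  qed (use that in \<open>simp add: S_def\<close>)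
  have "range (\<lambda>n. restrict (t ^^ n) S) \<subseteq> S \<rightarrow>\<^sub>E S" using tS by auto
  then have "finite (range (\<lambda>n. restrict (t ^^ n) S))"
    by (rule finite_subset) (intro finite_PiE fin)
  then have "\<not> inj (\<lambda>n. restrict (t ^^ n) S)" using range_inj_infinite by blast
  then obtain i j where ij: "i < j" "restrict (t ^^ i) S = restrict (t ^^ j) S"
    unfolding inj_def by (metis linorder_neqE_nat)
  define e where "e = j - i"
  have S_central: "a \<otimes> d [^] e = d [^] e \<otimes> a" if a: "a \<in> S" for a
  proof -
    have ac: "a \<in> carrier M" "(t ^^ i) a \<in> carrier M" using a tS[OF a] by (auto simp: S_def)
    have "(t ^^ i) a = (t ^^ j) a" using ij(2) a by (metis restrict_apply')
    \<comment> \<open>Only \<open>t ^^ i\<close> and \<open>t ^^ j\<close> are known to agree on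
      \<open>S\<close>, so \<open>d [^] i\<close> is appended on both sides and cancelled at the
      end.\<close>
    have "(a \<otimes> d [^] e) \<otimes> d [^] i = a \<otimes> d [^] j"
      using ij ac dc by (simp add: e_def m_assoc nat_pow_mult)
    also have "\<dots> = d [^] (e + i) \<otimes> (t ^^ i) a"
      using shift[OF a, of j] \<open>(t ^^ i) a = (t ^^ j) a\<close> ij by (simp add: e_def)
    also have "\<dots> = d [^] e \<otimes> (a \<otimes> d [^] i)"
      using shift[OF a, of i] ac dc by (simp add: m_assoc nat_pow_mult[symmetric])
    finally have "(a \<otimes> d [^] e) \<otimes> d [^] i = (d [^] e \<otimes> a) \<otimes> d [^] i"
      using ac dc by (simp add: m_assoc)
    then show ?thesis by (rule r_cancel) (use ac dc in auto)
  qed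
  have gen: "generates M S" using d by (simp add: garside_element_def S_def)
  have "x \<otimes> d [^] e = d [^] e \<otimes> x" if "x \<in> carrier M" for x
    using gen that
  proof (induction rule: generates_induct)
    case (mult x y)
    then have xc: "x \<in> carrier M" by (simp add: S_def)
    have "(x \<otimes> y) \<otimes> d [^] e = (x \<otimes> d [^] e) \<otimes> y"
      using xc mult dc by (simp add: m_assoc)
    then show ?case using S_central[OF mult(1)] xc mult dc by (simp add: m_assoc)
  qed (use dc in simp)
  then show ?thesis using ij by (intro exI[of _ e]) (auto simp: e_def)
qed

text \<open>Each generator divides \<open>d\<close>, hence the central element
  \<open>d [^] e\<close>. Centrality lets the complements of successive factors be gathered on the
  right.\<close>

lemma divides_garside_power:
  assumes d: "garside_element M d" and e: "0 < (e::nat)"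
    and central: "\<And>x. x \<in> carrier M \<Longrightarrow> x \<otimes> d [^] e = d [^] e \<otimes> x"
    and a: "a \<in> carrier M"
  shows "\<exists>k::nat. left_le M a ((d [^] e) [^] k)"
proof -
  have dc: "d \<in> carrier M" using d by (simp add: garside_element_def)
  have gen: "generates M {a \<in> carrier M. left_le M a d}" using d by (simp add: garside_element_def)
  show ?thesis
    using gen a
  proof (induction rule: generates_induct)
    case one
    show ?case by (intro exI[of _ 0]) (auto simp: left_le_def)
  next
    case (mult x y)
    then obtain k :: nat and c where c: "c \<in> carrier M" "y \<otimes> c = (d [^] e) [^] k"
      by (auto simp: left_le_def)
    from mult obtain b where b: "b \<in> carrier M" "x \<otimes> b = d" and xc: "x \<in> carrier M"
      by (auto simp: left_le_def)
    define b' where "b' = b \<otimes> d [^] (e - 1)"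
    have "x \<otimes> b' = (x \<otimes> b) \<otimes> d [^] (e - 1)"
      unfolding b'_def using b xc dc by (intro m_assoc[symmetric]) auto
    also have "\<dots> = d [^] e" using b(2) e dc nat_pow_Suc2[OF dc, of "e - 1"] by simp
    finally have b': "b' \<in> carrier M" "x \<otimes> b' = d [^] e" using b dc by (auto simp: b'_def)
    have pow_central: "z \<otimes> (d [^] e) [^] k = (d [^] e) [^] k \<otimes> z" if "z \<in> carrier M" for z
      using that dc
    proof (induction k)
      case (Suc k)
      then have "z \<otimes> (d [^] e) [^] Suc k = (d [^] e) [^] k \<otimes> (z \<otimes> d [^] e)"
        by (simp add: m_assoc[symmetric])
      then show ?case using Suc central[OF that] by (simp add: m_assoc)
    qed simp
    have "(x \<otimes> y) \<otimes> (c \<otimes> b') = x \<otimes> ((y \<otimes> c) \<otimes> b')"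
      using xc c(1) b'(1) mult(2) by (simp add: m_assoc)
    also have "\<dots> = x \<otimes> (b' \<otimes> (d [^] e) [^] k)" using c(2) pow_central[OF b'(1)] by simp
    also have "\<dots> = d [^] e \<otimes> (d [^] e) [^] k" using b' xc dc by (simp add: m_assoc[symmetric])
    also have "\<dots> = (d [^] e) [^] Suc k" using dc nat_pow_Suc2[of "d [^] e" k] by simp
    finally show ?case using c b' by (intro exI[of _ "Suc k"]) (auto simp: left_le_def)
  qed
qed

end

section \<open>The order on the group of fractions\<close>

context garside_group begin

text \<open>The positive cone is the image of \<open>M\<close>, and \<open>D\<close> the image of a
  central Garside power. Powers of \<open>D\<close> clear denominators, which reduces the axioms on
  \<open>G\<close> to divisibility in \<open>M\<close>.\<close>

lemma garside_order_fractions: "\<exists>D. garside_order G (\<iota> ` carrier M) D"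
proof -
  interpret G: group G using fractions by (simp add: group_of_fractions_def)
  have hom: "\<iota> \<in> hom M G" and inj: "inj_on \<iota> (carrier M)"
    and carrier_G: "carrier G = {inv\<^bsub>G\<^esub> (\<iota> a) \<otimes>\<^bsub>G\<^esub> \<iota> b | a b. a \<in> carrier M \<and> b \<in> carrier M}"
    using fractions by (auto simp: group_of_fractions_def)
  have \<iota>_closed [simp]: "\<iota> a \<in> carrier G" if "a \<in> carrier M" for a
    using hom_in_carrier[OF hom that] .
  have \<iota>_mult: "\<iota> (a \<otimes>\<^bsub>M\<^esub> b) = \<iota> a \<otimes>\<^bsub>G\<^esub> \<iota> b" if "a \<in> carrier M" "b \<in> carrier M" for a b
    using hom_mult[OF hom that] .
  have \<iota>_one: "\<iota> \<one>\<^bsub>M\<^esub> = \<one>\<^bsub>G\<^esub>"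
    using \<iota>_mult[of "\<one>\<^bsub>M\<^esub>" "\<one>\<^bsub>M\<^esub>"] G.r_cancel_one'[of "\<iota> \<one>\<^bsub>M\<^esub>" "\<iota> \<one>\<^bsub>M\<^esub>"] by simp
  have \<iota>_pow: "\<iota> (a [^]\<^bsub>M\<^esub> (n::nat)) = \<iota> a [^]\<^bsub>G\<^esub> n" if "a \<in> carrier M" for a n
    by (induction n) (use that in \<open>simp_all add: \<iota>_one \<iota>_mult\<close>)
  let ?Q = "\<iota> ` carrier M"
  have le_iff: "inv\<^bsub>G\<^esub> (\<iota> a) \<otimes>\<^bsub>G\<^esub> \<iota> b \<in> ?Q \<longleftrightarrow> left_le M a b"
    if ab: "a \<in> carrier M" "b \<in> carrier M" for a b
  proof
    assume "inv\<^bsub>G\<^esub> (\<iota> a) \<otimes>\<^bsub>G\<^esub> \<iota> b \<in> ?Q"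
    then obtain c where c: "c \<in> carrier M" "inv\<^bsub>G\<^esub> (\<iota> a) \<otimes>\<^bsub>G\<^esub> \<iota> b = \<iota> c" by auto
    then have "\<iota> b = \<iota> (a \<otimes>\<^bsub>M\<^esub> c)"
      using ab by (simp add: \<iota>_mult G.m_assoc[symmetric] flip: c(2))
    then have "b = a \<otimes>\<^bsub>M\<^esub> c" using inj ab c by (auto simp: inj_on_def)
    then show "left_le M a b" using c by (auto simp: left_le_def)
  next
    assume "left_le M a b"
    then obtain c where c: "c \<in> carrier M" "a \<otimes>\<^bsub>M\<^esub> c = b" by (auto simp: left_le_def)
    then have "inv\<^bsub>G\<^esub> (\<iota> a) \<otimes>\<^bsub>G\<^esub> \<iota> b = \<iota> c"
      using ab by (simp add: \<iota>_mult G.m_assoc[symmetric] flip: c(2))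
    then show "inv\<^bsub>G\<^esub> (\<iota> a) \<otimes>\<^bsub>G\<^esub> \<iota> b \<in> ?Q" using c by auto
  qed
  obtain d where d: "garside_element M d" using ex_garside_element by blast
  then have dc: "d \<in> carrier M" by (simp add: garside_element_def)
  obtain e :: nat where e: "0 < e"
    and central: "\<And>x. x \<in> carrier M \<Longrightarrow> x \<otimes>\<^bsub>M\<^esub> d [^]\<^bsub>M\<^esub> e = d [^]\<^bsub>M\<^esub> e \<otimes>\<^bsub>M\<^esub> x"
    using central_garside_power[OF d] by blast
  define D' where "D' = d [^]\<^bsub>M\<^esub> e"
  define D where "D = \<iota> D'"
  have D'c: "D' \<in> carrier M" and Dc: "D \<in> carrier G" using dc by (auto simp: D'_def D_def)
  have D_pow: "D [^]\<^bsub>G\<^esub> k = \<iota> (D' [^]\<^bsub>M\<^esub> k)" for k :: nat using D'c by (simp add: D_def \<iota>_pow)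
  have D_pow_closed: "D' [^]\<^bsub>M\<^esub> k \<in> carrier M" for k :: nat using D'c by simp
  have D_central: "x \<otimes>\<^bsub>G\<^esub> D = D \<otimes>\<^bsub>G\<^esub> x" if x: "x \<in> carrier G" for x
  proof -
    \<comment> \<open>The elements commuting with \<open>D\<close> form a subgroup containing the
      image of \<open>M\<close>, which generates \<open>G\<close>.\<close>
    note C = G.commutant_subgroup[OF Dc]
    have "\<iota> a \<in> {y \<in> carrier G. D \<otimes>\<^bsub>G\<^esub> y = y \<otimes>\<^bsub>G\<^esub> D}" if "a \<in> carrier M" for a
      using that central[OF that] dc by (auto simp: D_def D'_def simp flip: \<iota>_mult)
    then have "x \<in> {y \<in> carrier G. D \<otimes>\<^bsub>G\<^esub> y = y \<otimes>\<^bsub>G\<^esub> D}"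
      using x subgroup.m_closed[OF C] subgroup.m_inv_closed[OF C] unfolding carrier_G by blast
    then show ?thesis by simp
  qed
  have D_pow_central: "x \<otimes>\<^bsub>G\<^esub> D [^]\<^bsub>G\<^esub> k = D [^]\<^bsub>G\<^esub> k \<otimes>\<^bsub>G\<^esub> x" if x: "x \<in> carrier G" for x and k :: nat
  proof (induction k)
    case (Suc k)
    have "x \<otimes>\<^bsub>G\<^esub> D [^]\<^bsub>G\<^esub> Suc k = D [^]\<^bsub>G\<^esub> k \<otimes>\<^bsub>G\<^esub> (x \<otimes>\<^bsub>G\<^esub> D)"
      using Suc x Dc by (simp add: G.m_assoc[symmetric])
    also have "\<dots> = D [^]\<^bsub>G\<^esub> k \<otimes>\<^bsub>G\<^esub> (D \<otimes>\<^bsub>G\<^esub> x)" by (simp only: D_central[OF x])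
    also have "\<dots> = D [^]\<^bsub>G\<^esub> Suc k \<otimes>\<^bsub>G\<^esub> x" using x Dc by (simp add: G.m_assoc)
    finally show ?case .
  qed (use x in simp)
  have Q_mult: "x \<otimes>\<^bsub>G\<^esub> y \<in> ?Q" if "x \<in> ?Q" "y \<in> ?Q" for x y
    using that by (auto simp flip: \<iota>_mult)
  have archimedean: "\<exists>k::nat. D [^]\<^bsub>G\<^esub> k \<otimes>\<^bsub>G\<^esub> x \<in> ?Q" if "x \<in> carrier G" for x
  proof -
    obtain a b where ab: "a \<in> carrier M" "b \<in> carrier M" "x = inv\<^bsub>G\<^esub> (\<iota> a) \<otimes>\<^bsub>G\<^esub> \<iota> b"
      using \<open>x \<in> carrier G\<close> unfolding carrier_G by blast
    obtain k :: nat where "left_le M a (D' [^]\<^bsub>M\<^esub> k)"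
      using divides_garside_power[OF d e central ab(1)] by (auto simp: D'_def)
    then have "inv\<^bsub>G\<^esub> (\<iota> a) \<otimes>\<^bsub>G\<^esub> D [^]\<^bsub>G\<^esub> k \<in> ?Q"
      unfolding D_pow using le_iff[OF ab(1) D_pow_closed] by simp
    then have "(inv\<^bsub>G\<^esub> (\<iota> a) \<otimes>\<^bsub>G\<^esub> D [^]\<^bsub>G\<^esub> k) \<otimes>\<^bsub>G\<^esub> \<iota> b \<in> ?Q"
      by (rule Q_mult) (use ab in auto)
    then show ?thesis using ab Dc D_pow_central[of "inv\<^bsub>G\<^esub> (\<iota> a)" k] by (auto simp: G.m_assoc)
  qed
  have le_shift: "inv\<^bsub>G\<^esub> (c \<otimes>\<^bsub>G\<^esub> x) \<otimes>\<^bsub>G\<^esub> (c \<otimes>\<^bsub>G\<^esub> y) = inv\<^bsub>G\<^esub> x \<otimes>\<^bsub>G\<^esub> y"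
    if "c \<in> carrier G" "x \<in> carrier G" "y \<in> carrier G" for c x y
    using that by (simp add: G.inv_mult_group G.m_assoc G.inv_cancel)
  have meets: "\<exists>z\<in>carrier G. inv\<^bsub>G\<^esub> z \<otimes>\<^bsub>G\<^esub> x \<in> ?Q \<and> inv\<^bsub>G\<^esub> z \<otimes>\<^bsub>G\<^esub> y \<in> ?Q \<and>
      (\<forall>w\<in>carrier G. inv\<^bsub>G\<^esub> w \<otimes>\<^bsub>G\<^esub> x \<in> ?Q \<and> inv\<^bsub>G\<^esub> w \<otimes>\<^bsub>G\<^esub> y \<in> ?Q \<longrightarrow>
        inv\<^bsub>G\<^esub> w \<otimes>\<^bsub>G\<^esub> z \<in> ?Q)"
    if xy: "x \<in> carrier G" "y \<in> carrier G" for x y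
  proof -
    have D_add: "D [^]\<^bsub>G\<^esub> (k + l) \<otimes>\<^bsub>G\<^esub> u = D [^]\<^bsub>G\<^esub> k \<otimes>\<^bsub>G\<^esub> (D [^]\<^bsub>G\<^esub> l \<otimes>\<^bsub>G\<^esub> u)"
      if "u \<in> carrier G" for k l :: nat and u
      using that Dc by (simp add: G.nat_pow_mult[symmetric] G.m_assoc)
    have D_Q: "D [^]\<^bsub>G\<^esub> (k::nat) \<in> ?Q" for k using D_pow D_pow_closed by auto
    obtain k1 k2 :: nat where k12: "D [^]\<^bsub>G\<^esub> k1 \<otimes>\<^bsub>G\<^esub> x \<in> ?Q" "D [^]\<^bsub>G\<^esub> k2 \<otimes>\<^bsub>G\<^esub> y \<in> ?Q"
      using archimedean xy by meson
    define k where "k = k1 + k2"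
    have "D [^]\<^bsub>G\<^esub> k \<otimes>\<^bsub>G\<^esub> x \<in> ?Q" "D [^]\<^bsub>G\<^esub> k \<otimes>\<^bsub>G\<^esub> y \<in> ?Q"
      using Q_mult[OF D_Q[of k2] k12(1)] Q_mult[OF D_Q[of k1] k12(2)] xy
      by (simp_all add: k_def add.commute[of k1 k2] flip: D_add)
    then obtain a b where a: "a \<in> carrier M" "D [^]\<^bsub>G\<^esub> k \<otimes>\<^bsub>G\<^esub> x = \<iota> a"
      and b: "b \<in> carrier M" "D [^]\<^bsub>G\<^esub> k \<otimes>\<^bsub>G\<^esub> y = \<iota> b"
      by auto
    obtain m where m: "m \<in> carrier M" "left_le M m a" "left_le M m b"
      and greatest: "\<And>w. \<lbrakk>w \<in> carrier M; left_le M w a; left_le M w b\<rbrakk> \<Longrightarrow> left_le M w m"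
      using left_meet[OF a(1) b(1)] by blast
    define z where "z = inv\<^bsub>G\<^esub> (D [^]\<^bsub>G\<^esub> k) \<otimes>\<^bsub>G\<^esub> \<iota> m"
    have zc: "z \<in> carrier G" using m Dc by (simp add: z_def)
    have Dz: "D [^]\<^bsub>G\<^esub> k \<otimes>\<^bsub>G\<^esub> z = \<iota> m" using m Dc by (simp add: z_def G.inv_cancel)
    have Dkc: "D [^]\<^bsub>G\<^esub> k \<in> carrier G" using Dc by simp
    have "inv\<^bsub>G\<^esub> z \<otimes>\<^bsub>G\<^esub> x \<in> ?Q" "inv\<^bsub>G\<^esub> z \<otimes>\<^bsub>G\<^esub> y \<in> ?Q"
      using le_shift[OF Dkc zc xy(1)] le_shift[OF Dkc zc xy(2)] le_iff[OF m(1) a(1)] le_iff[OF m(1) b(1)] m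
      by (simp_all add: a b Dz)
    moreover have "inv\<^bsub>G\<^esub> w \<otimes>\<^bsub>G\<^esub> z \<in> ?Q"
      if w: "w \<in> carrier G" "inv\<^bsub>G\<^esub> w \<otimes>\<^bsub>G\<^esub> x \<in> ?Q" "inv\<^bsub>G\<^esub> w \<otimes>\<^bsub>G\<^esub> y \<in> ?Q" for w
    proof -
      \<comment> \<open>After the shift by \<open>D [^] k\<close>, the lower bound \<open>w\<close>
        may still lie outside the image of \<open>M\<close>. A further shift by
        \<open>D [^] l\<close> brings it in, so meets in \<open>M\<close> must be compared before
        and after multiplication by \<open>?p\<close>.\<close>
      obtain l :: nat where "D [^]\<^bsub>G\<^esub> l \<otimes>\<^bsub>G\<^esub> (D [^]\<^bsub>G\<^esub> k \<otimes>\<^bsub>G\<^esub> w) \<in> ?Q"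
        using archimedean[of "D [^]\<^bsub>G\<^esub> k \<otimes>\<^bsub>G\<^esub> w"] w Dc by auto
      then obtain v where v: "v \<in> carrier M" "D [^]\<^bsub>G\<^esub> (l + k) \<otimes>\<^bsub>G\<^esub> w = \<iota> v"
        using w by (auto simp: D_add)
      let ?p = "D' [^]\<^bsub>M\<^esub> l"
      have lift: "D [^]\<^bsub>G\<^esub> (l + k) \<otimes>\<^bsub>G\<^esub> u = \<iota> (?p \<otimes>\<^bsub>M\<^esub> c)"
        if "D [^]\<^bsub>G\<^esub> k \<otimes>\<^bsub>G\<^esub> u = \<iota> c" "u \<in> carrier G" "c \<in> carrier M" for u c
        using that D_add[OF that(2), of l k] D_pow[of l] by (simp add: \<iota>_mult D_pow_closed)
      have Dlkc: "D [^]\<^bsub>G\<^esub> (l + k) \<in> carrier G" using Dc by simp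
      have pc: "?p \<in> carrier M" by (rule D_pow_closed)
      have le_v: "left_le M v (?p \<otimes>\<^bsub>M\<^esub> c) \<longleftrightarrow> inv\<^bsub>G\<^esub> w \<otimes>\<^bsub>G\<^esub> u \<in> ?Q"
        if "D [^]\<^bsub>G\<^esub> k \<otimes>\<^bsub>G\<^esub> u = \<iota> c" "u \<in> carrier G" "c \<in> carrier M" for u c
        using le_iff[OF v(1), of "?p \<otimes>\<^bsub>M\<^esub> c"] le_shift[OF Dlkc w(1) that(2)] that pc
        by (simp add: v(2) lift)
      have le_p: "left_le M (?p \<otimes>\<^bsub>M\<^esub> a1) (?p \<otimes>\<^bsub>M\<^esub> a2) \<longleftrightarrow> left_le M a1 a2"
        if "a1 \<in> carrier M" "a2 \<in> carrier M" for a1 a2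
        using that pc l_cancel[of ?p] by (fastforce simp: left_le_def m_assoc)
      obtain n where n: "n \<in> carrier M" "left_le M n (?p \<otimes>\<^bsub>M\<^esub> a)" "left_le M n (?p \<otimes>\<^bsub>M\<^esub> b)"
        and n_greatest: "\<And>u. \<lbrakk>u \<in> carrier M; left_le M u (?p \<otimes>\<^bsub>M\<^esub> a); left_le M u (?p \<otimes>\<^bsub>M\<^esub> b)\<rbrakk> \<Longrightarrow> left_le M u n"
        using left_meet[of "?p \<otimes>\<^bsub>M\<^esub> a" "?p \<otimes>\<^bsub>M\<^esub> b"] a b pc by auto
      \<comment> \<open>Since \<open>?p\<close> is a common divisor, it divides the meet
        \<open>n\<close> of the shifted pair. Cancelling it leaves a common divisor of
        \<open>a\<close> and \<open>b\<close>, hence one of \<open>m\<close>.\<close>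
      have "left_le M ?p n" using a b pc by (intro n_greatest) (auto simp: left_le_def)
      then obtain n' where n': "n' \<in> carrier M" "n = ?p \<otimes>\<^bsub>M\<^esub> n'" by (auto simp: left_le_def)
      then have "left_le M n' m" using n a b le_p by (intro greatest) auto
      then have "left_le M n (?p \<otimes>\<^bsub>M\<^esub> m)" using le_p n' m by simp
      moreover have "left_le M v n" using w a b v xy le_v by (intro n_greatest) auto
      ultimately have "left_le M v (?p \<otimes>\<^bsub>M\<^esub> m)"
        using left_le_trans v n pc m by blast
      then show ?thesis using le_v[OF Dz zc m(1)] by simp
    qed
    ultimately show ?thesis using zc by blast
  qed
  have "garside_order G ?Q D"
  proof unfold_locales
    show "?Q \<subseteq> carrier G" by auto
    show "\<one>\<^bsub>G\<^esub> \<in> ?Q" using \<iota>_one by (metis imageI one_closed)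
    show "D \<in> ?Q" using D'c by (simp add: D_def)
    show "a = \<one>\<^bsub>G\<^esub>" if a: "a \<in> ?Q" "inv\<^bsub>G\<^esub> a \<in> ?Q" for a
    proof -
      obtain b c where bc: "b \<in> carrier M" "a = \<iota> b" "c \<in> carrier M" "inv\<^bsub>G\<^esub> a = \<iota> c" using a by auto
      have "\<iota> (b \<otimes>\<^bsub>M\<^esub> c) = \<iota> \<one>\<^bsub>M\<^esub>"
        using bc G.r_inv[of a] by (simp add: \<iota>_mult \<iota>_one)
      then have "b \<otimes>\<^bsub>M\<^esub> c = \<one>\<^bsub>M\<^esub>" using inj bc by (auto simp: inj_on_def)
      then have "b = \<one>\<^bsub>M\<^esub>" using unit_free bc(1,3) by blast
      then show ?thesis using bc(2) \<iota>_one by simp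
    qed
    show "finite {m \<in> ?Q. inv\<^bsub>G\<^esub> m \<otimes>\<^bsub>G\<^esub> D [^]\<^bsub>G\<^esub> k \<in> ?Q}" for k :: nat
    proof (rule finite_subset)
      show "{m \<in> ?Q. inv\<^bsub>G\<^esub> m \<otimes>\<^bsub>G\<^esub> D [^]\<^bsub>G\<^esub> k \<in> ?Q} \<subseteq>
          \<iota> ` {a \<in> carrier M. left_le M a (D' [^]\<^bsub>M\<^esub> k)}"
        using le_iff D_pow_closed by (auto simp: D_pow)
      show "finite (\<iota> ` {a \<in> carrier M. left_le M a (D' [^]\<^bsub>M\<^esub> k)})"
        using finite_left_divisors[OF D_pow_closed] by simp
    qed
  qed (use Q_mult D_central archimedean meets in auto)
  then show ?thesis ..
qed

end

section \<open>Enlarging the abelian subgroup and concluding\<close>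

theorem proposition3p5:
  fixes M :: "('m, 'p) monoid_scheme"
    and \<iota> :: "'m \<Rightarrow> 'g"
    and G :: "('g, 'q) monoid_scheme"
    and H :: "'g set"
  assumes "garside_group M \<iota> G"
    and "subgroup H G"
    and "comm_group (G\<lparr>carrier := H\<rparr>)"
  shows "finite_index G (normalizer G H) (centralizer G H)"
proof -
  obtain D where "garside_order G (\<iota> ` carrier M) D"
    using garside_group.garside_order_fractions[OF assms(1)] by blast
  then interpret garside_order G "\<iota> ` carrier M" D .
  interpret H: subgroup H G by (rule assms(2))
  have H_comm: "a \<otimes>\<^bsub>G\<^esub> b = b \<otimes>\<^bsub>G\<^esub> a" if "a \<in> H" "b \<in> H" for a b
    using comm_groupE(4)[OF assms(3), of a b] that by simp
  have D_int_central: "x \<otimes>\<^bsub>G\<^esub> D [^]\<^bsub>G\<^esub> (k::int) = D [^]\<^bsub>G\<^esub> k \<otimes>\<^bsub>G\<^esub> x" if "x \<in> carrier G" for x k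
  proof -
    have "D \<in> {y \<in> carrier G. x \<otimes>\<^bsub>G\<^esub> y = y \<otimes>\<^bsub>G\<^esub> x}" using that D_central by simp
    from subgroup_int_pow_closed[OF commutant_subgroup[OF that] this, of k] show ?thesis by simp
  qed
  have lcomm: "x \<otimes>\<^bsub>G\<^esub> (D [^]\<^bsub>G\<^esub> (k::int) \<otimes>\<^bsub>G\<^esub> y) = D [^]\<^bsub>G\<^esub> k \<otimes>\<^bsub>G\<^esub> (x \<otimes>\<^bsub>G\<^esub> y)"
    if "x \<in> carrier G" "y \<in> carrier G" for x y k
    using that D_int_central[OF that(1)] by (simp add: m_assoc[symmetric])
  \<comment> \<open>Adjoining the central element \<open>D\<close> keeps the subgroup abelian and
    supplies the unit required in \<open>garside_abelian\<close>.\<close>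
  define A where "A = {D [^]\<^bsub>G\<^esub> (k::int) \<otimes>\<^bsub>G\<^esub> h | h k. h \<in> H}"
  have A_I: "D [^]\<^bsub>G\<^esub> (k::int) \<otimes>\<^bsub>G\<^esub> h \<in> A" if "h \<in> H" for h k using that by (auto simp: A_def)
  have mult: "(D [^]\<^bsub>G\<^esub> (k::int) \<otimes>\<^bsub>G\<^esub> h) \<otimes>\<^bsub>G\<^esub> (D [^]\<^bsub>G\<^esub> l \<otimes>\<^bsub>G\<^esub> h') =
      D [^]\<^bsub>G\<^esub> (k + l) \<otimes>\<^bsub>G\<^esub> (h \<otimes>\<^bsub>G\<^esub> h')" if "h \<in> H" "h' \<in> H" for h h' k l
    using that by (simp add: m_assoc lcomm[of h] int_pow_mult)
  have A_subgroup: "subgroup A G"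
  proof (rule subgroupI)
    show "A \<subseteq> carrier G" by (auto simp: A_def)
    show "A \<noteq> {}" using A_I H.one_closed by blast
    show "inv\<^bsub>G\<^esub> a \<in> A" if aA: "a \<in> A" for a
    proof -
      obtain h and k :: int where a: "h \<in> H" "a = D [^]\<^bsub>G\<^esub> k \<otimes>\<^bsub>G\<^esub> h"
        using aA unfolding A_def by blast
      then have "inv\<^bsub>G\<^esub> a = D [^]\<^bsub>G\<^esub> (- k) \<otimes>\<^bsub>G\<^esub> inv\<^bsub>G\<^esub> h"
        using D_int_central[of "inv\<^bsub>G\<^esub> h" "- k"] by (simp add: inv_mult_group int_pow_neg)
      then show ?thesis using a A_I by simp
    qed
    show "a \<otimes>\<^bsub>G\<^esub> b \<in> A" if ab: "a \<in> A" "b \<in> A" for a b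
    proof -
      obtain h h' and k l :: int where "h \<in> H" "a = D [^]\<^bsub>G\<^esub> k \<otimes>\<^bsub>G\<^esub> h"
        "h' \<in> H" "b = D [^]\<^bsub>G\<^esub> l \<otimes>\<^bsub>G\<^esub> h'"
        using ab unfolding A_def by blast
      then show ?thesis using A_I[of "h \<otimes>\<^bsub>G\<^esub> h'" "k + l"] by (simp add: mult)
    qed
  qed
  have A_comm: "a \<otimes>\<^bsub>G\<^esub> b = b \<otimes>\<^bsub>G\<^esub> a" if ab: "a \<in> A" "b \<in> A" for a b
  proof -
    obtain h h' and k l :: int where "h \<in> H" "a = D [^]\<^bsub>G\<^esub> k \<otimes>\<^bsub>G\<^esub> h"
      "h' \<in> H" "b = D [^]\<^bsub>G\<^esub> l \<otimes>\<^bsub>G\<^esub> h'"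
      using ab unfolding A_def by blast
    then show ?thesis using H_comm by (simp add: mult add.commute)
  qed
  have D_A: "D \<in> A" using A_I[OF H.one_closed, of 1] by simp
  interpret garside_abelian G "\<iota> ` carrier M" D A
    by (intro garside_abelian.intro garside_abelian_axioms.intro garside_order_axioms
        A_subgroup A_comm D_A)
  have HA: "H \<subseteq> A" using A_I[of _ 0] by auto
  \<comment> \<open>Conjugation fixes powers of \<open>D\<close>, so an element normalizing
    \<open>H\<close> also maps \<open>A\<close> into itself.\<close>
  have norm: "normalizer G H \<subseteq> normalizing"
  proof
    fix z assume "z \<in> normalizer G H"
    then have zc: "z \<in> carrier G" and z: "\<And>h. h \<in> H \<Longrightarrow> z \<otimes>\<^bsub>G\<^esub> h \<otimes>\<^bsub>G\<^esub> inv\<^bsub>G\<^esub> z \<in> H"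
      using mem_normalizer_iff[OF H.subset] by auto
    have "z \<otimes>\<^bsub>G\<^esub> (D [^]\<^bsub>G\<^esub> (k::int) \<otimes>\<^bsub>G\<^esub> h) \<otimes>\<^bsub>G\<^esub> inv\<^bsub>G\<^esub> z =
        D [^]\<^bsub>G\<^esub> k \<otimes>\<^bsub>G\<^esub> (z \<otimes>\<^bsub>G\<^esub> h \<otimes>\<^bsub>G\<^esub> inv\<^bsub>G\<^esub> z)" if "h \<in> H" for h k
      using that zc by (simp add: m_assoc lcomm[of z])
    then have "z \<otimes>\<^bsub>G\<^esub> a \<otimes>\<^bsub>G\<^esub> inv\<^bsub>G\<^esub> z \<in> A" if "a \<in> A" for a
      using that A_I[OF z] unfolding A_def by force
    then show "z \<in> normalizing" using zc by (simp add: normalizing_def)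
  qed
  obtain S where S: "finite S" "S \<subseteq> A"
    "\<And>z h. \<lbrakk>z \<in> normalizing; \<forall>s\<in>S. z \<otimes>\<^bsub>G\<^esub> s = s \<otimes>\<^bsub>G\<^esub> z; h \<in> A\<rbrakk> \<Longrightarrow> z \<otimes>\<^bsub>G\<^esub> h = h \<otimes>\<^bsub>G\<^esub> z"
    using finitely_detected_A unfolding finitely_detected_def by blast
  show ?thesis
  proof (rule finite_index_centralizer)
    show "finite {z \<otimes>\<^bsub>G\<^esub> s \<otimes>\<^bsub>G\<^esub> inv\<^bsub>G\<^esub> z | z. z \<in> normalizer G H}" if "s \<in> S" for s
      by (rule finite_subset[OF _ finite_orbit[of s]]) (use that S norm in auto)
    show "z \<in> centralizer G H"
      if "z \<in> normalizer G H" "\<forall>s\<in>S. z \<otimes>\<^bsub>G\<^esub> s = s \<otimes>\<^bsub>G\<^esub> z" for z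
    proof -
      have "z \<in> normalizing" using that(1) norm by blast
      moreover have "z \<otimes>\<^bsub>G\<^esub> h = h \<otimes>\<^bsub>G\<^esub> z" if "h \<in> H" for h
        using S(3)[OF \<open>z \<in> normalizing\<close> \<open>\<forall>s\<in>S. z \<otimes>\<^bsub>G\<^esub> s = s \<otimes>\<^bsub>G\<^esub> z\<close>] that HA by blast
      ultimately show ?thesis by (simp add: centralizer_def normalizing_def)
    qed
  qed (use S H.subset in auto)
qed

end
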